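(* Let $n$ and $m$ be integers with $n\geq 6$ and $5\leq m\leq 2n-3$. Then $H_{n,m}$ is a $3$-uniformly most reliable two-terminal graph ($3$-UMRTTG) in $T_{n,m}$, and it is the only one (every $3$-UMRTTG in $T_{n,m}$ is isomorphic to $H_{n,m}$ as a two-terminal graph).
   Context: All graphs are finite, simple and undirected. A two-terminal graph is a graph $G$ together with two distinguished vertices $s,t$ (the terminals). Two two-terminal graphs are isomorphic if there is a graph isomorphism between them mapping the set of terminals onto the set of terminals. $T_{n,m}$ denotes the set of all pairwise nonisomorphic two-terminal graphs with $n$ vertices and $m$ edges. For a positive integer $d$, a $d$-pathset of a two-terminal graph $G$ is a spanning subgraph of $G$ containing a path of length (number of edges) at most $d$ joining $s$ and $t$. For $\rho\in[0,1]$, $R_G^d(\rho)$ is the probability that the random spanning subgraph obtained from $G$ by deleting each edge independently with probability $\rho$ is a $d$-pathset. A graph $G\in T_{n,m}$ is a $d$-UMRTTG if $R_G^d(\rho)\geq R_H^d(\rho)$ for every $H\in T_{n,m}$ and every $\rho\in[0,1]$. For integers $k\geq 3$ and $r\in\{0,1,\ldots,k-3\}$, $A_{k,r}$ is the two-terminal graph with vertex set $\{s,t,v_3,\ldots,v_k\}$, terminals $s,t$, and edge set $\{st\}\cup\{sv_i,v_it: 3\leq i\leq k\}\cup\{v_3v_{3+j}: 1\leq j\leq r\}$. For $n\geq 5$ and $5\leq m\leq 2n-3$, $H_{n,m}\in T_{n,m}$ is obtained from $A_{(m+2)/2,1}$ by adding $n-\frac{m+2}{2}$ isolated vertices when $m$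 is even, and from $A_{(m+3)/2,0}$ by adding $n-\frac{m+3}{2}$ isolated vertices when $m$ is odd. *)

theory Defs
  imports Complex_Main
begin

record 'a ttg =
  verts :: "'a set"
  edges :: "'a set set"
  term_s :: 'a
  term_t :: 'a

definition wf_ttg :: "'a ttg \<Rightarrow> bool" where
  "wf_ttg G \<longleftrightarrow> finite (verts G)
     \<and> edges G \<subseteq> {{u, v} | u v. u \<in> verts G \<and> v \<in> verts G \<and> u \<noteq> v}
     \<and> term_s G \<in> verts G \<and> term_t G \<in> verts G \<and> term_s G \<noteq> term_t G"

definition in_T :: "nat \<Rightarrow> nat \<Rightarrow> 'a ttg \<Rightarrow> bool" where
  "in_T n m G \<longleftrightarrow> wf_ttg G \<and> card (verts G) = n \<and> card (edges G) = m"

definition ttg_iso :: "'a ttg \<Rightarrow> 'b ttg \<Rightarrow> bool" where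
  "ttg_iso G H \<longleftrightarrow> (\<exists>f. bij_betw f (verts G) (verts H)
     \<and> (\<forall>u\<in>verts G. \<forall>v\<in>verts G. {u, v} \<in> edges G \<longleftrightarrow> {f u, f v} \<in> edges H)
     \<and> f ` {term_s G, term_t G} = {term_s H, term_t H})"

definition has_short_path :: "'a set set \<Rightarrow> 'a \<Rightarrow> 'a \<Rightarrow> nat \<Rightarrow> bool" where
  "has_short_path F s t d \<longleftrightarrow> (\<exists>p. p \<noteq> [] \<and> hd p = s \<and> last p = t \<and> distinct p
      \<and> (\<forall>i. Suc i < length p \<longrightarrow> {p ! i, p ! Suc i} \<in> F)
      \<and> length p - 1 \<le> d)"

definition is_pathset :: "nat \<Rightarrow> 'a ttg \<Rightarrow> 'a set set \<Rightarrow> bool" where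
  "is_pathset d G F \<longleftrightarrow> F \<subseteq> edges G \<and> has_short_path F (term_s G) (term_t G) d"

text \<open>R_G^d(rho): probability that the random spanning subgraph, obtained by deleting each
  edge independently with probability rho, is a d-pathset.\<close>
definition rel :: "nat \<Rightarrow> 'a ttg \<Rightarrow> real \<Rightarrow> real" where
  "rel d G \<rho> = (\<Sum>F\<in>{F. F \<subseteq> edges G \<and> is_pathset d G F}.
       (1 - \<rho>) ^ card F * \<rho> ^ card (edges G - F))"

definition is_UMRTTG :: "nat \<Rightarrow> nat \<Rightarrow> nat \<Rightarrow> 'a ttg \<Rightarrow> bool" where
  "is_UMRTTG d n m G \<longleftrightarrow> in_T n m G \<and>
     (\<forall>H :: 'a ttg. in_T n m H \<longrightarrow> (\<forall>\<rho>\<in>{0..1}. rel d G \<rho> \<ge> rel d H \<rho>))"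

text \<open>Edge set of A_{k,r}, with s = 1, t = 2 and v_i = i for 3 \<le> i \<le> k.\<close>
definition A_edges :: "nat \<Rightarrow> nat \<Rightarrow> nat set set" where
  "A_edges k r = {{1, 2}} \<union> {{1, i} | i. 3 \<le> i \<and> i \<le> k} \<union> {{i, 2} | i. 3 \<le> i \<and> i \<le> k}
     \<union> {{3, 3 + j} | j. 1 \<le> j \<and> j \<le> r}"

definition A_graph :: "nat \<Rightarrow> nat \<Rightarrow> nat ttg" where
  "A_graph k r = \<lparr>verts = {1..k}, edges = A_edges k r, term_s = 1, term_t = 2\<rparr>"

text \<open>Adding p isolated vertices (named k+1, ..., k+p) to A_{k,r} on vertex set {1..k}.\<close>
definition add_isolated :: "nat ttg \<Rightarrow> nat \<Rightarrow> nat ttg" where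
  "add_isolated G p = G\<lparr>verts := verts G \<union> {card (verts G) + 1 .. card (verts G) + p}\<rparr>"

definition H_graph :: "nat \<Rightarrow> nat \<Rightarrow> nat ttg" where
  "H_graph n m = (if even m
     then add_isolated (A_graph ((m + 2) div 2) 1) (n - (m + 2) div 2)
     else add_isolated (A_graph ((m + 3) div 2) 0) (n - (m + 3) div 2))"

end

theory Submission
  imports Defs
begin

text \<open>
  Let \<open>p = 1 - \<rho>\<close> be the survival probability of an edge; we bound the probability that no path of
  length at most 3 survives from below. The edge \<open>st\<close> contributes a factor \<open>1 - p\<close>, so consider a graph
  without it. If \<open>x\<close> is adjacent to \<open>s\<close> but not to \<open>t\<close>, replacing another edge \<open>xy\<close> by \<open>xt\<close> shortens
  every short path that uses \<open>xy\<close>, and if there is no such edge then \<open>sx\<close> is useless. Hence we may assume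
  that \<open>s\<close> and \<open>t\<close> have the same neighbourhood \<open>C\<close>. Without further edges the unreliability is
  \<open>(1 - p\<^sup>2)\<^sup>c\<close> with \<open>c = card C\<close>. Each further edge \<open>xy\<close> multiplies it by at least
  \<open>\<theta> = 1 - 2p\<^sup>3 / (1 + p)\<^sup>2\<close>: conditioned on the absence of a short path, \<open>x\<close> and \<open>y\<close> are both attached to
  a terminal with probability at most \<open>(2p / (1 + p))\<^sup>2\<close>, and then to different terminals with probability
  at most 1/2, as one sees by flipping the component of \<open>y\<close>. Since \<open>\<theta>\<^sup>2 \<ge> 1 - p\<^sup>2\<close>, strictly for
  \<open>0 < p < 1\<close>, it is best to trade any two further edges for a new vertex of \<open>C\<close>.
\<close>

subsection \<open>Random subsets\<close>

text \<open>Expectation of \<open>f F\<close> for a random subset \<open>F\<close> of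
  \<open>E\<close> that keeps each element independently with probability \<open>p\<close>.\<close>

definition bexp :: "real \<Rightarrow> 'b set \<Rightarrow> ('b set \<Rightarrow> real) \<Rightarrow> real" where
  "bexp p E f = (\<Sum>F\<in>Pow E. p ^ card F * (1 - p) ^ card (E - F) * f F)"

lemma bexp_empty [simp]: "bexp p {} f = f {}"
  by (simp add: bexp_def)

text \<open>Condition on whether \<open>e\<close> is kept: the subsets of \<open>insert e E\<close>
  are the subsets \<open>F\<close> of \<open>E\<close> and the sets
  \<open>insert e F\<close>.\<close>

lemma bexp_insert:
  assumes "finite E" "e \<notin> E"
  shows "bexp p (insert e E) f = (1 - p) * bexp p E f + p * bexp p E (\<lambda>F. f (insert e F))"
proof -
  have inj: "inj_on (insert e) (Pow E)"
    using assms(2) by (auto simp: inj_on_def)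
  have disj: "Pow E \<inter> insert e ` Pow E = {}"
    using assms(2) by auto
  have "bexp p (insert e E) f =
      (\<Sum>F\<in>Pow E. p ^ card F * (1 - p) ^ card (insert e E - F) * f F) +
      (\<Sum>F\<in>Pow E. p ^ card (insert e F) * (1 - p) ^ card (insert e E - insert e F) * f (insert e F))"
    unfolding bexp_def Pow_insert using assms(1) disj
    by (simp add: sum.union_disjoint sum.reindex[OF inj])
  also have "(\<Sum>F\<in>Pow E. p ^ card F * (1 - p) ^ card (insert e E - F) * f F) = (1 - p) * bexp p E f"
    unfolding bexp_def sum_distrib_left
  proof (rule sum.cong[OF refl])
    fix F assume "F \<in> Pow E"
    then have "insert e E - F = insert e (E - F)" "e \<notin> E - F" "finite (E - F)"
      using assms by auto
    then show "p ^ card F * (1 - p) ^ card (insert e E - F) * f F =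
        (1 - p) * (p ^ card F * (1 - p) ^ card (E - F) * f F)"
      by simp
  qed
  also have "(\<Sum>F\<in>Pow E. p ^ card (insert e F) * (1 - p) ^ card (insert e E - insert e F) * f (insert e F))
      = p * bexp p E (\<lambda>F. f (insert e F))"
    unfolding bexp_def sum_distrib_left
  proof (rule sum.cong[OF refl])
    fix F assume F: "F \<in> Pow E"
    then have "insert e E - insert e F = E - F" "e \<notin> F" "finite F"
      using assms by (auto intro: finite_subset)
    then show "p ^ card (insert e F) * (1 - p) ^ card (insert e E - insert e F) * f (insert e F) =
        p * (p ^ card F * (1 - p) ^ card (E - F) * f (insert e F))"
      by simp
  qed
  finally show ?thesis .
qed

lemma bexp_cong: "E = E' \<Longrightarrow> (\<And>F. F \<subseteq> E' \<Longrightarrow> f F = g F) \<Longrightarrow> bexp p E f = bexp p E' g"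
  by (auto simp: bexp_def intro!: sum.cong)

lemma bexp_mono:
  assumes "0 \<le> p" "p \<le> 1" "\<And>F. F \<subseteq> E \<Longrightarrow> f F \<le> g F"
  shows "bexp p E f \<le> bexp p E g"
  unfolding bexp_def by (intro sum_mono mult_left_mono) (use assms in auto)

text \<open>For \<open>0 < p < 1\<close> every subset has positive weight, so a single subset with
  strict inequality decides.\<close>

lemma bexp_strict_mono:
  assumes "0 < p" "p < 1" "finite E" "\<And>F. F \<subseteq> E \<Longrightarrow> f F \<le> g F"
    and "F \<subseteq> E" "f F < g F"
  shows "bexp p E f < bexp p E g"
  unfolding bexp_def
proof (rule sum_strict_mono_ex1)
  show "\<forall>F\<in>Pow E. p ^ card F * (1 - p) ^ card (E - F) * f F \<le> p ^ card F * (1 - p) ^ card (E - F) * g F"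
    using assms by (auto intro!: mult_left_mono)
  show "\<exists>F\<in>Pow E. p ^ card F * (1 - p) ^ card (E - F) * f F < p ^ card F * (1 - p) ^ card (E - F) * g F"
    using assms by (auto intro!: bexI[of _ F])
qed (use assms in auto)

lemma bexp_const [simp]: "finite E \<Longrightarrow> bexp p E (\<lambda>_. c) = c"
  by (induction E rule: finite_induct) (auto simp: bexp_insert algebra_simps)

lemma bexp_cmult: "bexp p E (\<lambda>F. c * f F) = c * bexp p E f"
  by (simp add: bexp_def sum_distrib_left mult.left_commute)

lemma bexp_add: "bexp p E (\<lambda>F. f F + g F) = bexp p E f + bexp p E g"
  by (simp add: bexp_def sum.distrib algebra_simps)

text \<open>Random subsets of disjoint sets are independent, so the expectation can be taken in two
  stages.\<close>

lemma bexp_union: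
  assumes "finite A" "finite B" "A \<inter> B = {}"
  shows "bexp p (A \<union> B) f = bexp p A (\<lambda>F. bexp p B (\<lambda>F'. f (F \<union> F')))"
  using assms(1,3)
proof (induction A arbitrary: f rule: finite_induct)
  case (insert a A)
  then show ?case
    using assms(2) by (simp add: bexp_insert)
qed simp

lemma bexp_image:
  assumes "finite A" "inj_on g A"
  shows "bexp p (g ` A) f = bexp p A (\<lambda>S. f (g ` S))"
  using assms
proof (induction A arbitrary: f rule: finite_induct)
  case (insert a A)
  then show ?case by (simp add: bexp_insert)
qed simp

subsection \<open>Paths of length at most three\<close>

text \<open>The disjuncts are the paths with one, two and three edges, so that a case distinction
  replaces reasoning about vertex lists.\<close>

definition linked :: "'a \<Rightarrow> 'a \<Rightarrow> 'a set set \<Rightarrow> bool" where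
  "linked s t F \<longleftrightarrow> {s, t} \<in> F
     \<or> (\<exists>x. x \<noteq> s \<and> x \<noteq> t \<and> {s, x} \<in> F \<and> {x, t} \<in> F)
     \<or> (\<exists>x y. x \<noteq> s \<and> x \<noteq> t \<and> y \<noteq> s \<and> y \<noteq> t \<and> x \<noteq> y \<and> {s, x} \<in> F \<and> {x, y} \<in> F \<and> {y, t} \<in> F)"

lemma linked_mono: "linked s t F \<Longrightarrow> F \<subseteq> F' \<Longrightarrow> linked s t F'"
  unfolding linked_def by blast

lemma linkedE:
  assumes "linked s t F"
  obtains "{s, t} \<in> F"
    | x where "x \<noteq> s" "x \<noteq> t" "{s, x} \<in> F" "{x, t} \<in> F"
    | x y where "x \<noteq> s" "x \<noteq> t" "y \<noteq> s" "y \<noteq> t" "x \<noteq> y" "{s, x} \<in> F" "{x, y} \<in> F" "{y, t} \<in> F"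
  using assms unfolding linked_def by blast

lemma linked_sym: "linked s t F \<longleftrightarrow> linked t s F"
proof -
  have "linked t s F" if "linked s t F" for s t :: 'a and F
    using that
  proof (cases rule: linkedE)
    case 1
    then show ?thesis by (simp add: linked_def insert_commute)
  next
    case (2 x)
    then have "{t, x} \<in> F" "{x, s} \<in> F" by (simp_all add: insert_commute)
    then show ?thesis using 2 unfolding linked_def by blast
  next
    case (3 x y)
    then have "{t, y} \<in> F" "{y, x} \<in> F" "{x, s} \<in> F" by (simp_all add: insert_commute)
    then show ?thesis using 3 unfolding linked_def by blast
  qed
  then show ?thesis by blast
qed

text \<open>A path with at most three edges is a list of one to four vertices, and
  \<open>s \<noteq> t\<close> rules out the list of length one.\<close>

lemma has_short_path_3:
  assumes "s \<noteq> t"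
  shows "has_short_path F s t 3 \<longleftrightarrow> linked s t F"
proof
  assume "has_short_path F s t 3"
  then obtain p where p: "p \<noteq> []" "hd p = s" "last p = t" "distinct p"
      "\<And>i. Suc i < length p \<Longrightarrow> {p ! i, p ! Suc i} \<in> F" "length p - 1 \<le> 3"
    unfolding has_short_path_def by blast
  have "length p \<le> 4" using p(6) by simp
  then consider "\<exists>a. p = [a]" | "\<exists>a b. p = [a, b]" | "\<exists>a b c. p = [a, b, c]"
    | "\<exists>a b c d. p = [a, b, c, d]"
    using p(1) by (cases p; cases "tl p"; cases "tl (tl p)"; cases "tl (tl (tl p))"; simp)
  then show "linked s t F"
  proof cases
    case 1
    then show ?thesis using p(2,3) assms by auto
  next
    case 2
    then show ?thesis using p(2,3) p(5)[of 0] by (auto simp: linked_def)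
  next
    case 3
    then obtain b where "p = [s, b, t]" using p(2,3) by auto
    then show ?thesis
      using p(4) p(5)[of 0] p(5)[of 1] unfolding linked_def by auto
  next
    case 4
    then obtain b c where "p = [s, b, c, t]" using p(2,3) by auto
    then show ?thesis
      using p(4) p(5)[of 0] p(5)[of 1] p(5)[of 2] unfolding linked_def
      by (auto simp: numeral_2_eq_2)
  qed
next
  assume "linked s t F"
  then show "has_short_path F s t 3"
  proof (cases rule: linkedE)
    case 1
    then show ?thesis unfolding has_short_path_def
      using assms by (intro exI[of _ "[s, t]"]) simp
  next
    case (2 x)
    then show ?thesis unfolding has_short_path_def
      using assms by (intro exI[of _ "[s, x, t]"]) (simp add: nth_Cons split: nat.split)
  next
    case (3 x y)
    then show ?thesis unfolding has_short_path_def
      using assms by (intro exI[of _ "[s, x, y, t]"]) (simp add: nth_Cons split: nat.split)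
  qed
qed

section \<open>Unreliability as the complement of reliability\<close>

definition unrel :: "real \<Rightarrow> 'a \<Rightarrow> 'a \<Rightarrow> 'a set set \<Rightarrow> real" where
  "unrel p s t E = bexp p E (\<lambda>F. of_bool (\<not> linked s t F))"

lemma unrel_sym: "unrel p s t E = unrel p t s E"
  by (simp add: unrel_def linked_sym[of s t])

text \<open>The probabilities of the two complementary events add up to 1. Here the deletion
  probability \<open>\<rho>\<close> of \<open>rel\<close> turns into the survival probability
  \<open>p = 1 - \<rho>\<close> used in all estimates.\<close>

lemma rel_3_eq:
  assumes "wf_ttg G"
  shows "rel 3 G \<rho> = 1 - unrel (1 - \<rho>) (term_s G) (term_t G) (edges G)"
proof -
  let ?s = "term_s G" and ?t = "term_t G" and ?E = "edges G"
  have st: "?s \<noteq> ?t" and "finite (verts G)" and "?E \<subseteq> Pow (verts G)"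
    using assms unfolding wf_ttg_def by auto
  then have fin: "finite ?E" by (meson finite_Pow_iff finite_subset)
  have "rel 3 G \<rho> = bexp (1 - \<rho>) ?E (\<lambda>F. of_bool (linked ?s ?t F))"
    unfolding rel_def bexp_def is_pathset_def has_short_path_3[OF st]
    using fin by (intro sum.mono_neutral_cong_left) auto
  moreover have "bexp (1 - \<rho>) ?E (\<lambda>F. of_bool (linked ?s ?t F)) + unrel (1 - \<rho>) ?s ?t ?E
      = bexp (1 - \<rho>) ?E (\<lambda>_. 1)"
    unfolding unrel_def bexp_add[symmetric] by (intro bexp_cong) auto
  ultimately show ?thesis using fin by simp
qed

subsection \<open>Separated pairs\<close>

text \<open>The condition \<open>x \<noteq> y\<close> excludes a path of length two through a common
  vertex, and \<open>{x, y} \<notin> \<Gamma>\<close> excludes one of length three.\<close>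

definition sep :: "'a set set \<Rightarrow> 'a set \<Rightarrow> 'a set \<Rightarrow> bool" where
  "sep \<Gamma> S T \<longleftrightarrow> (\<forall>x\<in>S. \<forall>y\<in>T. x \<noteq> y \<and> {x, y} \<notin> \<Gamma>)"

lemma sep_sym: "sep \<Gamma> S T \<longleftrightarrow> sep \<Gamma> T S"
  unfolding sep_def by (metis insert_commute)

lemma sep_subset: "sep \<Gamma> S T \<Longrightarrow> S' \<subseteq> S \<Longrightarrow> T' \<subseteq> T \<Longrightarrow> sep \<Gamma> S' T'"
  unfolding sep_def by blast

text \<open>If both terminals have neighbourhood \<open>C\<close>, let \<open>S\<close> and \<open>T\<close> be the sets of vertices whose edge to
  \<open>s\<close> and to \<open>t\<close> survives, and \<open>\<Gamma>\<close> the set of surviving edges avoiding the terminals: there is no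
  short path iff \<open>sep \<Gamma> S T\<close>.\<close>

definition sep_prob :: "real \<Rightarrow> 'a set \<Rightarrow> 'a set set \<Rightarrow> real" where
  "sep_prob p C \<Gamma> = bexp p C (\<lambda>S. bexp p C (\<lambda>T. of_bool (sep \<Gamma> S T)))"

section \<open>Probability weights of pairs of vertex sets\<close>

definition wt :: "real \<Rightarrow> 'a set \<Rightarrow> 'a set \<times> 'a set \<Rightarrow> real" where
  "wt p C = (\<lambda>(S, T). p ^ (card S + card T) * (1 - p) ^ (card (C - S) + card (C - T)))"

lemma wt_nonneg: "0 \<le> p \<Longrightarrow> p \<le> 1 \<Longrightarrow> 0 \<le> wt p C ST"
  by (auto simp: wt_def split: prod.split)

definition sep_pairs :: "'a set \<Rightarrow> 'a set set \<Rightarrow> ('a set \<times> 'a set) set" where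
  "sep_pairs C \<Gamma> = {(S, T). S \<subseteq> C \<and> T \<subseteq> C \<and> sep \<Gamma> S T}"

lemma finite_sep_pairs: "finite C \<Longrightarrow> finite (sep_pairs C \<Gamma>)"
  by (rule finite_subset[of _ "Pow C \<times> Pow C"]) (auto simp: sep_pairs_def)

lemma sep_prob_eq_sum:
  assumes "finite C"
  shows "sep_prob p C \<Gamma> = sum (wt p C) (sep_pairs C \<Gamma>)"
proof -
  have "sep_prob p C \<Gamma> = (\<Sum>(S, T)\<in>Pow C \<times> Pow C. wt p C (S, T) * of_bool (sep \<Gamma> S T))"
    unfolding sep_prob_def bexp_def sum_distrib_left sum.cartesian_product
    by (intro sum.cong) (auto simp: wt_def power_add)
  also have "\<dots> = sum (wt p C) (sep_pairs C \<Gamma>)"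
    using assms by (intro sum.mono_neutral_cong_right) (auto simp: sep_pairs_def)
  finally show ?thesis .
qed

text \<open>An injection that changes every weight by the same ratio compares the total weights. Two
  multipliers instead of a quotient avoid division by zero at the ends of the range of
  \<open>p\<close>.\<close>

lemma sum_wt_le:
  assumes "finite B" "inj_on \<phi> A" "\<phi> ` A \<subseteq> B" "0 \<le> p" "p \<le> 1"
    and "\<And>c. c \<in> A \<Longrightarrow> a * wt p C c = b * wt p C (\<phi> c)" "0 \<le> b"
  shows "a * sum (wt p C) A \<le> b * sum (wt p C) B"
proof -
  have "a * sum (wt p C) A = (\<Sum>c\<in>A. b * wt p C (\<phi> c))"
    using assms(6) by (simp add: sum_distrib_left)
  also have "\<dots> = b * sum (wt p C) (\<phi> ` A)"
    using assms(2) by (simp add: sum.reindex sum_distrib_left)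
  also have "\<dots> \<le> b * sum (wt p C) B"
    using assms by (intro mult_left_mono sum_mono2) (auto simp: wt_nonneg)
  finally show ?thesis .
qed

text \<open>Deleting \<open>x\<close> from \<open>S\<close> exchanges one factor \<open>p\<close>
  for one factor \<open>1 - p\<close>.\<close>

lemma wt_remove_fst:
  assumes "finite C" "S \<subseteq> C" "x \<in> S"
  shows "(1 - p) * wt p C (S, T) = p * wt p C (S - {x}, T)"
proof -
  have "finite S" using assms finite_subset by blast
  then have "card S = Suc (card (S - {x}))"
    using assms(3) by (metis card.remove)
  moreover have "C - (S - {x}) = insert x (C - S)" "x \<notin> C - S"
    using assms by auto
  then have "card (C - (S - {x})) = Suc (card (C - S))"
    using assms(1) by simp
  ultimately show ?thesis by (simp add: wt_def)
qed

lemma wt_swap: "wt p C (T, S) = wt p C (S, T)"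
  by (simp add: wt_def add.commute)

lemma sum_wt_swap: "sum (wt p C) (prod.swap ` A) = sum (wt p C) A"
proof -
  have "sum (wt p C) (prod.swap ` A) = sum (wt p C \<circ> prod.swap) A"
    by (intro sum.reindex) (auto simp: inj_on_def)
  also have "\<dots> = sum (wt p C) A"
    by (intro sum.cong) (auto simp: wt_swap)
  finally show ?thesis .
qed

text \<open>Connected component of \<open>y\<close> in the subgraph of \<open>\<Gamma>\<close>
  induced on \<open>Z\<close>; the closure is reflexive, so \<open>y\<close> always belongs to
  it.\<close>

definition component :: "'a set set \<Rightarrow> 'a set \<Rightarrow> 'a \<Rightarrow> 'a set" where
  "component \<Gamma> Z y = {(u, v). u \<in> Z \<and> v \<in> Z \<and> {u, v} \<in> \<Gamma>}\<^sup>* `` {y}"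

lemma self_in_component: "y \<in> component \<Gamma> Z y"
  by (simp add: component_def)

lemma component_closed:
  assumes "u \<in> component \<Gamma> Z y" "u \<in> Z" "v \<in> Z" "{u, v} \<in> \<Gamma>"
  shows "v \<in> component \<Gamma> Z y"
  using assms unfolding component_def by (auto intro: rtrancl_into_rtrancl)

text \<open>A walk inside \<open>S \<union> T\<close> that starts in \<open>T\<close> never reaches
  \<open>S\<close>, because no edge of \<open>\<Gamma>\<close> joins the two sides.\<close>

lemma component_subset:
  assumes "sep \<Gamma> S T" "y \<in> T"
  shows "component \<Gamma> (S \<union> T) y \<subseteq> T"
proof
  fix z assume "z \<in> component \<Gamma> (S \<union> T) y"
  then have "(y, z) \<in> {(u, v). u \<in> S \<union> T \<and> v \<in> S \<union> T \<and> {u, v} \<in> \<Gamma>}\<^sup>*"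
    by (simp add: component_def)
  then show "z \<in> T"
  proof (induction rule: rtrancl_induct)
    case (step u v)
    then show ?case using assms(1) unfolding sep_def by (auto simp: insert_commute)
  qed (rule assms)
qed

text \<open>The component of \<open>y\<close> in the graph induced on \<open>S \<union> T\<close> lies on one side, and flipping it to the
  other side is an injection because \<open>S \<union> T\<close> does not change.\<close>

lemma sum_wt_flip:
  assumes "finite C" "0 \<le> p" "p \<le> 1"
  shows "sum (wt p C) {(S, T) \<in> sep_pairs C \<Gamma>. x \<in> S \<and> y \<in> T}
       \<le> sum (wt p C) {(S, T) \<in> sep_pairs C \<Gamma>. x \<in> S \<and> y \<in> S}"
proof -
  let ?A = "{(S, T) \<in> sep_pairs C \<Gamma>. x \<in> S \<and> y \<in> T}"
  let ?B = "{(S, T) \<in> sep_pairs C \<Gamma>. x \<in> S \<and> y \<in> S}"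
  define \<phi> where "\<phi> = (\<lambda>(S, T). let K = component \<Gamma> (S \<union> T) y in (S \<union> K, T - K))"
  have K: "component \<Gamma> (S \<union> T) y \<subseteq> T" "S \<inter> T = {}" "S \<subseteq> C" "T \<subseteq> C" "sep \<Gamma> S T"
    if "(S, T) \<in> ?A" for S T
  proof -
    show "sep \<Gamma> S T" "S \<subseteq> C" "T \<subseteq> C" using that by (auto simp: sep_pairs_def)
    then show "S \<inter> T = {}" by (auto simp: sep_def)
    show "component \<Gamma> (S \<union> T) y \<subseteq> T"
      using that \<open>sep \<Gamma> S T\<close> by (intro component_subset) auto
  qed
  have "inj_on \<phi> ?A"
  proof (rule inj_onI)
    fix c d assume c: "c \<in> ?A" and d: "d \<in> ?A" and eq: "\<phi> c = \<phi> d"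
    obtain S T S' T' where cd: "c = (S, T)" "d = (S', T')" by fastforce
    let ?K = "component \<Gamma> (S \<union> T) y" and ?K' = "component \<Gamma> (S' \<union> T') y"
    have e: "S \<union> ?K = S' \<union> ?K'" "T - ?K = T' - ?K'"
      using eq by (auto simp: \<phi>_def cd Let_def)
    have k: "?K \<subseteq> T" "?K' \<subseteq> T'" "S \<inter> T = {}" "S' \<inter> T' = {}"
      using K c d unfolding cd by blast+
    have "S \<union> T = S' \<union> T'" using e k by blast
    then have "?K = ?K'" by simp
    then show "c = d" using e k unfolding cd by blast
  qed
  moreover have "\<phi> ` ?A \<subseteq> ?B"
  proof (rule image_subsetI)
    fix c assume c: "c \<in> ?A"
    obtain S T where ST: "c = (S, T)" by fastforce
    let ?K = "component \<Gamma> (S \<union> T) y"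
    note k = K[OF c[unfolded ST]]
    have "sep \<Gamma> (S \<union> ?K) (T - ?K)"
      unfolding sep_def
    proof (intro ballI conjI)
      fix a b assume a: "a \<in> S \<union> ?K" and b: "b \<in> T - ?K"
      show "a \<noteq> b" using a b k by auto
      show "{a, b} \<notin> \<Gamma>"
      proof (cases "a \<in> S")
        case True
        then show ?thesis using b k by (auto simp: sep_def)
      next
        case False
        \<comment> \<open>An edge from the flipped component to the rest of \<open>T\<close> would
          put its other end into the component.\<close>
        then show ?thesis using a b k(1) component_closed[of a \<Gamma> "S \<union> T" y b] by auto
      qed
    qed
    moreover have "y \<in> ?K" by (rule self_in_component)
    ultimately show "\<phi> c \<in> ?B"
      using c k by (auto simp: \<phi>_def ST Let_def sep_pairs_def)
  qed
  \<comment> \<open>The weight depends only on \<open>card S + card T\<close>, which does not change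
    when a part of \<open>T\<close> moves to \<open>S\<close>.\<close>
  moreover have "1 * wt p C c = 1 * wt p C (\<phi> c)" if "c \<in> ?A" for c
  proof -
    obtain S T where ST: "c = (S, T)" by fastforce
    let ?K = "component \<Gamma> (S \<union> T) y"
    note k = K[OF that[unfolded ST]]
    have fin: "finite S" "finite T" using k assms(1) finite_subset by blast+
    then have fK: "finite ?K" using k(1) finite_subset by blast
    have 1: "card (S \<union> ?K) = card S + card ?K"
      using fin fK k by (intro card_Un_disjoint) auto
    have 2: "card (T - ?K) + card ?K = card T"
      using k(1) fK fin by (simp add: card_Diff_subset card_mono)
    have 3: "card (C - X) + card X = card C" if "X \<subseteq> C" for X
      using that assms(1) by (simp add: card_Diff_subset card_mono finite_subset)
    have "S \<union> ?K \<subseteq> C" "T - ?K \<subseteq> C" using k by auto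
    note 3[OF this(1)] 3[OF this(2)] 3[OF k(3)] 3[OF k(4)]
    then have "card (C - (S \<union> ?K)) + card (C - (T - ?K)) = card (C - S) + card (C - T)"
      "card (S \<union> ?K) + card (T - ?K) = card S + card T"
      using 1 2 by linarith+
    then show ?thesis by (simp add: \<phi>_def ST Let_def wt_def)
  qed
  ultimately have "1 * sum (wt p C) ?A \<le> 1 * sum (wt p C) ?B"
    using assms finite_subset[OF _ finite_sep_pairs[OF assms(1), of \<Gamma>], of ?B]
    by (intro sum_wt_le[of _ \<phi>]) auto
  then show ?thesis by simp
qed

section \<open>Effect of an additional edge or vertex on separation\<close>

text \<open>The new edge destroys exactly the separated pairs in which \<open>x\<close> and
  \<open>y\<close> lie on different sides. Deleting one of these vertices from its side, or flipping
  the component of \<open>y\<close>, maps such pairs injectively into the other classes of separated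
  pairs, so they form at most the fraction \<open>2 * p\<^sup>2 / (1 + p)\<^sup>2\<close>.\<close>

lemma sep_prob_insert_edge:
  assumes "finite C" "0 \<le> p" "p \<le> 1" "x \<noteq> y"
  shows "sep_prob p C (insert {x, y} \<Gamma>) \<ge> (1 - 2 * p\<^sup>2 / (1 + p)\<^sup>2) * sep_prob p C \<Gamma>"
proof -
  let ?D = "sep_pairs C \<Gamma>"
  let ?w = "sum (wt p C)"
  let ?n = "\<lambda>z S T. z \<notin> S \<and> z \<notin> T"
  \<comment> \<open>The first letter of a class gives the place of \<open>x\<close>, the second that
    of \<open>y\<close>; \<open>Z\<close> stands for neither \<open>S\<close> nor
    \<open>T\<close>.\<close>
  let ?ST = "{(S, T) \<in> ?D. x \<in> S \<and> y \<in> T}" and ?TS = "{(S, T) \<in> ?D. x \<in> T \<and> y \<in> S}"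
  let ?SS = "{(S, T) \<in> ?D. x \<in> S \<and> y \<in> S}" and ?TT = "{(S, T) \<in> ?D. x \<in> T \<and> y \<in> T}"
  let ?SZ = "{(S, T) \<in> ?D. x \<in> S \<and> ?n y S T}" and ?TZ = "{(S, T) \<in> ?D. x \<in> T \<and> ?n y S T}"
  let ?ZS = "{(S, T) \<in> ?D. ?n x S T \<and> y \<in> S}" and ?ZT = "{(S, T) \<in> ?D. ?n x S T \<and> y \<in> T}"
  let ?ZZ = "{(S, T) \<in> ?D. ?n x S T \<and> ?n y S T}"
  note finD = finite_sep_pairs[OF assms(1), of \<Gamma>]
  have fin: "finite {(S, T) \<in> ?D. P S T}" for P
    by (rule finite_subset[OF _ finD]) auto
  have disj: "S \<inter> T = {}" if "(S, T) \<in> ?D" for S T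
    using that by (auto simp: sep_pairs_def sep_def)
  have swapD: "(T, S) \<in> ?D \<longleftrightarrow> (S, T) \<in> ?D" for S T
    by (auto simp: sep_pairs_def sep_sym)
  have swap: "?w {(S, T) \<in> ?D. P T S} = ?w {(S, T) \<in> ?D. P S T}" for P
  proof -
    have "{(S, T) \<in> ?D. P T S} = prod.swap ` {(S, T) \<in> ?D. P S T}"
      using swapD by (auto simp: image_iff)
    then show ?thesis by (simp add: sum_wt_swap)
  qed
  have sym: "?w ?TS = ?w ?ST" "?w ?TT = ?w ?SS" "?w ?TZ = ?w ?SZ" "?w ?ZT = ?w ?ZS"
    using swap[of "\<lambda>S T. x \<in> S \<and> y \<in> T"] swap[of "\<lambda>S T. x \<in> S \<and> y \<in> S"]
      swap[of "\<lambda>S T. x \<in> S \<and> ?n y S T"] swap[of "\<lambda>S T. ?n x S T \<and> y \<in> S"]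
    by (simp_all add: conj_commute)
  \<comment> \<open>Deleting \<open>z\<close> from \<open>S\<close> is injective on pairs with
    \<open>z \<in> S\<close> and keeps them separated. Only the first component is treated;
    exchanging the terminals covers the second.\<close>
  have remove: "(1 - p) * ?w {(S, T) \<in> ?D. P S T} \<le> p * ?w {(S, T) \<in> ?D. Q S T}"
    if "\<And>S T. (S, T) \<in> ?D \<Longrightarrow> P S T \<Longrightarrow> z \<in> S \<and> Q (S - {z}) T" for P Q z
  proof (rule sum_wt_le[where \<phi> = "\<lambda>(S, T). (S - {z}, T)"])
    show "inj_on (\<lambda>(S, T). (S - {z}, T)) {(S, T) \<in> ?D. P S T}"
      using that by (auto simp: inj_on_def)
    show "(\<lambda>(S, T). (S - {z}, T)) ` {(S, T) \<in> ?D. P S T} \<subseteq> {(S, T) \<in> ?D. Q S T}"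
      using that by (auto simp: sep_pairs_def intro: sep_subset)
    show "(1 - p) * wt p C c = p * wt p C (case c of (S, T) \<Rightarrow> (S - {z}, T))"
      if c: "c \<in> {(S, T) \<in> ?D. P S T}" for c
    proof -
      obtain S T where ST: "c = (S, T)" "(S, T) \<in> ?D" "P S T" using c by auto
      have "z \<in> S" "S \<subseteq> C"
        using \<open>\<And>S T. (S, T) \<in> ?D \<Longrightarrow> P S T \<Longrightarrow> z \<in> S \<and> Q (S - {z}) T\<close>[OF ST(2,3)] ST(2)
        by (auto simp: sep_pairs_def)
      then show ?thesis using wt_remove_fst[OF assms(1)] ST(1) by simp
    qed
  qed (use fin assms in auto)
  define q where "q = 1 - p"
  have q: "0 \<le> q" using assms by (simp add: q_def)
  have r1: "q * ?w ?ST \<le> p * ?w ?ZT"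
    unfolding q_def by (rule remove[of _ x]) (use disj assms(4) in auto)
  have r2: "q * ?w ?TS \<le> p * ?w ?TZ"
    unfolding q_def by (rule remove[of _ y]) (use disj assms(4) in auto)
  have r3: "q * ?w ?SZ \<le> p * ?w ?ZZ"
    unfolding q_def by (rule remove[of _ x]) (use disj assms(4) in auto)
  have flip: "?w ?ST \<le> ?w ?SS"
    using assms by (intro sum_wt_flip)
  define u where "u = ?w ?ST"
  define N where "N = ?w ?D"
  \<comment> \<open>As \<open>S\<close> and \<open>T\<close> are disjoint, each of \<open>x\<close>
    and \<open>y\<close> has exactly three possible places, which gives nine classes.\<close>
  have "?D = ?ZZ \<union> (?SZ \<union> (?TZ \<union> (?ZS \<union> (?ZT \<union> (?SS \<union> (?TT \<union> (?ST \<union> ?TS)))))))"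
    by auto
  then have "N = ?w (?ZZ \<union> (?SZ \<union> (?TZ \<union> (?ZS \<union> (?ZT \<union> (?SS \<union> (?TT \<union> (?ST \<union> ?TS))))))))"
    unfolding N_def by simp
  also have "\<dots> = ?w ?ZZ + (?w ?SZ + (?w ?TZ + (?w ?ZS + (?w ?ZT + (?w ?SS + (?w ?TT + (?w ?ST + ?w ?TS)))))))"
    by (subst sum.union_disjoint, (intro fin finite_UnI)+, use disj in blast)+ (rule refl)
  finally have N: "N = ?w ?ZZ + 2 * ?w ?SZ + 2 * ?w ?ZS + 2 * ?w ?SS + 2 * u"
    using sym by (simp add: u_def)
  \<comment> \<open>The four estimates bound the terms of \<open>(q + 2p)\<^sup>2 u\<close> by the matching terms of \<open>p\<^sup>2 N\<close>.\<close>
  have "q\<^sup>2 * u \<le> p\<^sup>2 * ?w ?ZZ"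
  proof -
    have "q\<^sup>2 * u = q * (q * ?w ?TS)" using sym by (simp add: u_def power2_eq_square)
    also have "\<dots> \<le> q * (p * ?w ?TZ)" using r2 q by (rule mult_left_mono)
    also have "\<dots> = p * (q * ?w ?SZ)" using sym by simp
    also have "\<dots> \<le> p * (p * ?w ?ZZ)" using r3 assms(2) by (rule mult_left_mono)
    finally show ?thesis by (simp add: power2_eq_square)
  qed
  moreover have "p * (q * u) \<le> p * (p * ?w ?ZS)"
    using r1 sym assms(2) by (intro mult_left_mono) (auto simp: u_def)
  moreover have "p * (q * u) \<le> p * (p * ?w ?SZ)"
    using r2 sym assms(2) by (intro mult_left_mono) (auto simp: u_def)
  moreover have "p\<^sup>2 * u \<le> p\<^sup>2 * ?w ?SS"
    using flip by (simp add: u_def mult_left_mono)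
  ultimately have "(q + 2 * p)\<^sup>2 * u \<le> p\<^sup>2 * N"
    unfolding N by (simp add: power2_eq_square algebra_simps)
  \<comment> \<open>Here \<open>q + 2 * p = 1 + p\<close>, since \<open>q = 1 - p\<close>.\<close>
  then have "(1 + p)\<^sup>2 * u \<le> p\<^sup>2 * N" by (simp add: q_def add.commute)
  then have u: "u \<le> p\<^sup>2 / (1 + p)\<^sup>2 * N"
    using assms(2) by (simp add: field_simps)
  have "sep_pairs C (insert {x, y} \<Gamma>) = ?D - (?ST \<union> ?TS)"
    by (auto simp: sep_pairs_def sep_def doubleton_eq_iff)
  then have "sep_prob p C (insert {x, y} \<Gamma>) = ?w ?D - ?w (?ST \<union> ?TS)"
    using assms(1) finD by (simp only: sep_prob_eq_sum) (intro sum_diff, auto)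
  also have "?w (?ST \<union> ?TS) = ?w ?ST + ?w ?TS"
    using disj by (intro sum.union_disjoint fin) blast
  finally have "sep_prob p C (insert {x, y} \<Gamma>) = N - 2 * u"
    using sym by (simp add: N_def u_def)
  moreover have "sep_prob p C \<Gamma> = N" using assms(1) by (simp add: sep_prob_eq_sum N_def)
  moreover have "(1 - 2 * p\<^sup>2 / (1 + p)\<^sup>2) * N = N - 2 * (p\<^sup>2 / (1 + p)\<^sup>2 * N)"
    by (simp add: left_diff_distrib)
  ultimately show ?thesis using u by simp
qed

text \<open>Since \<open>z\<close> lies on no edge of \<open>\<Gamma>\<close>, its only constraint
  is not to belong to both sides; this has probability \<open>1 - p\<^sup>2\<close> and is
  independent of the rest.\<close>

lemma sep_prob_insert_vertex:
  assumes "finite C" "z \<notin> C" "z \<notin> \<Union>\<Gamma>"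
  shows "sep_prob p (insert z C) \<Gamma> = (1 - p\<^sup>2) * sep_prob p C \<Gamma>"
proof -
  have *: "sep \<Gamma> (insert z S) T \<longleftrightarrow> sep \<Gamma> S T" "sep \<Gamma> S (insert z T) \<longleftrightarrow> sep \<Gamma> S T"
    "\<not> sep \<Gamma> (insert z S) (insert z T)" if "S \<subseteq> C" "T \<subseteq> C" for S T
    using that assms(2,3) by (auto simp: sep_def)
  have "bexp p C (\<lambda>S. bexp p C (\<lambda>T. of_bool (sep \<Gamma> (insert z S) T))) = sep_prob p C \<Gamma>"
    "bexp p C (\<lambda>S. bexp p C (\<lambda>T. of_bool (sep \<Gamma> S (insert z T)))) = sep_prob p C \<Gamma>"
    "bexp p C (\<lambda>S. bexp p C (\<lambda>T. of_bool (sep \<Gamma> (insert z S) (insert z T)))) = bexp p C (\<lambda>S. bexp p C (\<lambda>T. 0))"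
    unfolding sep_prob_def by (intro bexp_cong; simp add: *)+
  then show ?thesis
    using assms(1,2)
    by (simp add: sep_prob_def bexp_insert bexp_add bexp_cmult) (simp add: power2_eq_square algebra_simps)
qed

lemma sep_prob_empty_graph:
  assumes "finite C"
  shows "sep_prob p C {} = (1 - p\<^sup>2) ^ card C"
  using assms
proof (induction C rule: finite_induct)
  case empty
  then show ?case by (simp add: sep_prob_def sep_def)
qed (simp add: sep_prob_insert_vertex)

text \<open>This is \<open>\<theta>\<close>, the average of 1 (the edge fails) and
  \<open>1 - 2 * p\<^sup>2 / (1 + p)\<^sup>2\<close> (the edge survives).\<close>

definition edge_factor :: "real \<Rightarrow> real" where
  "edge_factor p = 1 - 2 * p ^ 3 / (1 + p)\<^sup>2"

text \<open>For one edge inside \<open>C\<close> the factor \<open>edge_factor p\<close> is exact.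
  The other vertices of \<open>C\<close> split off, and a computation on \<open>{x, y}\<close>
  remains.\<close>

lemma sep_prob_single_edge:
  assumes "finite C" "x \<in> C" "y \<in> C" "x \<noteq> y" "0 \<le> p"
  shows "(1 - p) * sep_prob p C {} + p * sep_prob p C {{x, y}} = edge_factor p * (1 - p\<^sup>2) ^ card C"
proof -
  define q where "q = 1 - p"
  \<comment> \<open>With the edge present, any vertex in \<open>S\<close> conflicts with any vertex
    in \<open>T\<close>. Hence one of the two sets is empty, and inclusion-exclusion gives the
    value.\<close>
  have core: "sep_prob p {x, y} {{x, y}} = 2 * q ^ 2 - q ^ 4"
    using assms(4)
    by (simp add: sep_prob_def bexp_insert sep_def doubleton_eq_iff q_def)
      (simp add: power2_eq_square power4_eq_xxxx algebra_simps)
  have "sep_prob p ({x, y} \<union> D) {{x, y}} = (1 - p\<^sup>2) ^ card D * sep_prob p {x, y} {{x, y}}"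
    if "finite D" "D \<inter> {x, y} = {}" for D
    using that
  proof (induction D rule: finite_induct)
    case (insert z D)
    then have "sep_prob p (insert z ({x, y} \<union> D)) {{x, y}} = (1 - p\<^sup>2) * sep_prob p ({x, y} \<union> D) {{x, y}}"
      by (intro sep_prob_insert_vertex) auto
    then show ?case using insert by (simp add: Un_insert_right)
  qed simp
  from this[of "C - {x, y}"] have "sep_prob p C {{x, y}} = (1 - p\<^sup>2) ^ (card C - 2) * (2 * q ^ 2 - q ^ 4)"
    using assms core by (simp add: insert_absorb card_Diff_subset numeral_2_eq_2)
  moreover have "2 \<le> card C"
    using card_mono[of C "{x, y}"] assms by simp
  then have pow: "(1 - p\<^sup>2) ^ card C = (1 - p\<^sup>2) ^ (card C - 2) * (1 - p\<^sup>2)\<^sup>2"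
    by (metis le_add_diff_inverse2 power_add)
  ultimately have "(1 - p) * sep_prob p C {} + p * sep_prob p C {{x, y}} =
      (1 - p\<^sup>2) ^ (card C - 2) * (q * (1 - p\<^sup>2)\<^sup>2 + p * (2 * q ^ 2 - q ^ 4))"
    using assms(1) by (simp only: sep_prob_empty_graph pow q_def[symmetric] ring_distribs mult.left_commute)
  \<comment> \<open>The aim is to split off \<open>(1 - p\<^sup>2)\<^sup>2\<close>, which equals
    \<open>q\<^sup>2 * (1 + p)\<^sup>2\<close>.\<close>
  also have "q * (1 - p\<^sup>2)\<^sup>2 + p * (2 * q ^ 2 - q ^ 4) = q\<^sup>2 * ((1 + p)\<^sup>2 - 2 * p ^ 3)"
    unfolding q_def by algebra
  also have "(1 + p)\<^sup>2 - 2 * p ^ 3 = edge_factor p * (1 + p)\<^sup>2"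
    using assms(5) by (simp add: edge_factor_def field_simps)
  also have "q\<^sup>2 * (edge_factor p * (1 + p)\<^sup>2) = edge_factor p * (1 - p\<^sup>2)\<^sup>2"
    unfolding q_def by algebra
  finally show ?thesis by (simp add: pow)
qed

subsection \<open>Graphs in which both terminals have the same neighbours\<close>

text \<open>The complete bipartite graph between \<open>{s, t}\<close> and \<open>C\<close>.\<close>

definition star :: "'a \<Rightarrow> 'a \<Rightarrow> 'a set \<Rightarrow> 'a set set" where
  "star s t C = (\<lambda>x. {s, x}) ` C \<union> (\<lambda>x. {t, x}) ` C"

lemma finite_star: "finite C \<Longrightarrow> finite (star s t C)"
  by (simp add: star_def)

lemma star_meets_terminals: "e \<in> star s t C \<Longrightarrow> s \<in> e \<or> t \<in> e"
  by (auto simp: star_def)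

lemma star_disjoint:
  assumes "s \<noteq> t" "s \<notin> C" "t \<notin> C"
  shows "(\<lambda>x. {s, x}) ` C \<inter> (\<lambda>x. {t, x}) ` C = {}"
  using assms by (auto simp: doubleton_eq_iff)

lemma inj_on_doubleton: "inj_on (\<lambda>x. {s, x}) C"
  by (auto simp: inj_on_def doubleton_eq_iff)

lemma card_star:
  assumes "s \<noteq> t" "s \<notin> C" "t \<notin> C" "finite C"
  shows "card (star s t C) = 2 * card C"
  unfolding star_def using assms
  by (simp add: card_Un_disjoint star_disjoint card_image inj_on_doubleton)

text \<open>A path of length two is a common element of \<open>S\<close> and \<open>T\<close>, and
  one of length three an edge of \<open>\<Gamma>\<close> from \<open>S\<close> to \<open>T\<close>.
  The edge \<open>{s, t}\<close> is absent because \<open>t \<notin> S\<close>,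
  \<open>s \<notin> T\<close> and \<open>\<Gamma>\<close> avoids the terminals.\<close>

lemma linked_iff_not_sep:
  assumes "s \<noteq> t" "s \<notin> S" "t \<notin> S" "s \<notin> T" "t \<notin> T" "\<And>e. e \<in> \<Gamma> \<Longrightarrow> s \<notin> e \<and> t \<notin> e"
  shows "linked s t (\<Gamma> \<union> ((\<lambda>x. {s, x}) ` S \<union> (\<lambda>x. {t, x}) ` T)) \<longleftrightarrow> \<not> sep \<Gamma> S T"
proof -
  define F where "F = \<Gamma> \<union> ((\<lambda>x. {s, x}) ` S \<union> (\<lambda>x. {t, x}) ` T)"
  have g: "{s, a} \<notin> \<Gamma>" "{a, t} \<notin> \<Gamma>" for a using assms(6) by auto
  have memS: "{s, a} \<in> F \<longleftrightarrow> a \<in> S" for a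
    unfolding F_def using assms g by (auto simp: doubleton_eq_iff image_iff)
  have memT: "{a, t} \<in> F \<longleftrightarrow> a \<in> T" for a
    unfolding F_def using assms g by (auto simp: doubleton_eq_iff image_iff)
  have mem: "{a, b} \<in> F \<longleftrightarrow> {a, b} \<in> \<Gamma>" if "a \<noteq> s" "a \<noteq> t" "b \<noteq> s" "b \<noteq> t" for a b
    unfolding F_def using that by (auto simp: doubleton_eq_iff)
  have "linked s t F \<longleftrightarrow> \<not> sep \<Gamma> S T"
  proof
    assume "linked s t F"
    then show "\<not> sep \<Gamma> S T"
    proof (cases rule: linkedE)
      case 1
      then show ?thesis using memS[of t] assms by simp
    next
      case (2 x)
      then have "x \<in> S" "x \<in> T" by (simp_all add: memS memT)
      then show ?thesis by (auto simp: sep_def)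
    next
      case (3 x y)
      then have "x \<in> S" "y \<in> T" "{x, y} \<in> \<Gamma>" by (simp_all add: memS memT mem)
      then show ?thesis by (auto simp: sep_def)
    qed
  next
    assume "\<not> sep \<Gamma> S T"
    then obtain x y where xy: "x \<in> S" "y \<in> T" "x = y \<or> {x, y} \<in> \<Gamma>"
      by (auto simp: sep_def)
    have n: "x \<noteq> s" "x \<noteq> t" "y \<noteq> s" "y \<noteq> t" using xy assms by auto
    have m: "{s, x} \<in> F" "{y, t} \<in> F" using xy by (simp_all add: memS memT)
    show "linked s t F"
    proof (cases "x = y")
      case True
      then show ?thesis using m n unfolding linked_def by blast
    next
      case False
      then have "{x, y} \<in> F" using xy n by (simp add: mem)
      then show ?thesis using m n False unfolding linked_def by blast
    qed
  qed
  then show ?thesis by (simp add: F_def)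
qed

text \<open>The surviving edges of \<open>M\<close>, those at \<open>s\<close> and those at
  \<open>t\<close> are independent; fixing the first as \<open>\<Gamma>\<close> leaves two
  independent random subsets of \<open>C\<close>.\<close>

lemma unrel_star:
  assumes "s \<noteq> t" "s \<notin> C" "t \<notin> C" "finite C" "finite M" "\<And>e. e \<in> M \<Longrightarrow> s \<notin> e \<and> t \<notin> e"
  shows "unrel p s t (star s t C \<union> M) = bexp p M (sep_prob p C)"
proof -
  have "M \<inter> star s t C = {}"
    using assms(6) star_meets_terminals by fastforce
  then have "unrel p s t (star s t C \<union> M) =
      bexp p M (\<lambda>\<Gamma>. bexp p (star s t C) (\<lambda>F. of_bool (\<not> linked s t (\<Gamma> \<union> F))))"
    unfolding unrel_def using assms finite_star by (subst Un_commute) (intro bexp_union)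
  also have "\<dots> = bexp p M (sep_prob p C)"
  proof (rule bexp_cong[OF refl])
    fix \<Gamma> assume \<Gamma>: "\<Gamma> \<subseteq> M"
    have "bexp p (star s t C) (\<lambda>F. of_bool (\<not> linked s t (\<Gamma> \<union> F))) =
        bexp p C (\<lambda>S. bexp p C (\<lambda>T. of_bool (\<not> linked s t (\<Gamma> \<union> ((\<lambda>x. {s, x}) ` S \<union> (\<lambda>x. {t, x}) ` T)))))"
      unfolding star_def using assms star_disjoint[OF assms(1-3)]
      by (simp add: bexp_union bexp_image inj_on_doubleton)
    also have "\<dots> = sep_prob p C \<Gamma>"
      unfolding sep_prob_def
    proof (intro bexp_cong refl)
      fix S T assume "S \<subseteq> C" "T \<subseteq> C"
      then show "of_bool (\<not> linked s t (\<Gamma> \<union> ((\<lambda>x. {s, x}) ` S \<union> (\<lambda>x. {t, x}) ` T))) = of_bool (sep \<Gamma> S T)"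
        using assms \<Gamma> by (subst linked_iff_not_sep) auto
    qed
    finally show "bexp p (star s t C) (\<lambda>F. of_bool (\<not> linked s t (\<Gamma> \<union> F))) = sep_prob p C \<Gamma>" .
  qed
  finally show ?thesis .
qed

section \<open>Bounds for the edge factor and for middle edges\<close>

text \<open>With \<open>w = 4 * p / (1 + p)\<^sup>2\<close> the factor is
  \<open>1 - p\<^sup>2 * w / 2\<close>, and \<open>w \<le> 1\<close> amounts to
  \<open>(1 - p)\<^sup>2 \<ge> 0\<close>. Its square is at least \<open>1 - p\<^sup>2 * w\<close>,
  hence at least \<open>1 - p\<^sup>2\<close>; this is strict for \<open>0 < p < 1\<close>, where
  \<open>w < 1\<close>.\<close>

lemma edge_factor_bounds:
  assumes "0 \<le> p" "p \<le> 1"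
  shows "edge_factor p \<le> 1" "1 / 2 \<le> edge_factor p" "1 - p\<^sup>2 \<le> (edge_factor p)\<^sup>2"
    and "0 < p \<Longrightarrow> edge_factor p < 1" "0 < p \<Longrightarrow> p < 1 \<Longrightarrow> 1 - p\<^sup>2 < (edge_factor p)\<^sup>2"
proof -
  define w where "w = 4 * p / (1 + p)\<^sup>2"
  have pos: "(1 + p)\<^sup>2 > 0" using assms by simp
  have sq: "(1 + p)\<^sup>2 - 4 * p = (1 - p)\<^sup>2" by algebra
  have "4 * p \<le> (1 + p)\<^sup>2" using sq zero_le_power2[of "1 - p"] by linarith
  then have w: "0 \<le> w" "w \<le> 1"
    using assms pos by (auto simp: w_def divide_le_eq)
  have w1: "w < 1" if "p < 1"
  proof -
    have "0 < (1 - p)\<^sup>2" using that by simp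
    then have "4 * p < (1 + p)\<^sup>2" using sq by linarith
    then show ?thesis using pos by (simp add: w_def divide_less_eq)
  qed
  have e: "edge_factor p = 1 - p\<^sup>2 * w / 2"
    by (simp add: edge_factor_def w_def power2_eq_square power3_eq_cube)
  have p2: "0 \<le> p\<^sup>2" "p\<^sup>2 \<le> 1" using assms by (auto simp: power_le_one)
  show "edge_factor p \<le> 1" using w p2 by (simp add: e)
  have "p\<^sup>2 * w \<le> 1" using w p2 by (simp add: mult_le_one)
  then show "1 / 2 \<le> edge_factor p" by (simp add: e)
  have sqr: "(edge_factor p)\<^sup>2 = 1 - p\<^sup>2 * w + (p\<^sup>2 * w / 2)\<^sup>2"
    unfolding e by (simp add: power2_eq_square algebra_simps)
  have "p\<^sup>2 * w \<le> p\<^sup>2" using w p2 by (simp add: mult_left_le)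
  then show "1 - p\<^sup>2 \<le> (edge_factor p)\<^sup>2"
    using zero_le_power2[of "p\<^sup>2 * w / 2"] sqr by linarith
  show "edge_factor p < 1" if "0 < p" using that pos by (simp add: edge_factor_def)
  show "1 - p\<^sup>2 < (edge_factor p)\<^sup>2" if "0 < p" "p < 1"
  proof -
    have "p\<^sup>2 * w < p\<^sup>2" using w1[OF that(2)] that by simp
    then show ?thesis using zero_le_power2[of "p\<^sup>2 * w / 2"] sqr by linarith
  qed
qed

text \<open>Condition on the new edge, and apply the bound of \<open>sep_prob_insert_edge\<close> to
  every set \<open>\<Gamma>\<close> of other surviving middle edges.\<close>

lemma unrel_star_insert_edge:
  assumes "s \<noteq> t" "s \<notin> C" "t \<notin> C" "finite C" "finite M" "\<And>e. e \<in> insert {x, y} M \<Longrightarrow> s \<notin> e \<and> t \<notin> e"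
    and "x \<noteq> y" "{x, y} \<notin> M" "0 \<le> p" "p \<le> 1"
  shows "edge_factor p * unrel p s t (star s t C \<union> M) \<le> unrel p s t (star s t C \<union> insert {x, y} M)"
proof -
  have f: "edge_factor p * a = (1 - p) * a + p * ((1 - 2 * p\<^sup>2 / (1 + p)\<^sup>2) * a)" for a
    by (simp add: edge_factor_def power2_eq_square power3_eq_cube algebra_simps)
  have "edge_factor p * bexp p M (sep_prob p C)
      = (1 - p) * bexp p M (sep_prob p C) + p * bexp p M (\<lambda>\<Gamma>. (1 - 2 * p\<^sup>2 / (1 + p)\<^sup>2) * sep_prob p C \<Gamma>)"
    by (simp only: f bexp_cmult)
  also have "\<dots> \<le> (1 - p) * bexp p M (sep_prob p C) + p * bexp p M (\<lambda>\<Gamma>. sep_prob p C (insert {x, y} \<Gamma>))"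
    using assms by (intro add_left_mono mult_left_mono bexp_mono sep_prob_insert_edge)
  also have "\<dots> = bexp p (insert {x, y} M) (sep_prob p C)"
    using assms by (simp add: bexp_insert)
  also have "\<dots> = unrel p s t (star s t C \<union> insert {x, y} M)"
    using assms by (intro unrel_star[symmetric]) auto
  also have "bexp p M (sep_prob p C) = unrel p s t (star s t C \<union> M)"
    using assms by (intro unrel_star[symmetric]) auto
  finally show ?thesis .
qed

lemma unrel_star_ge:
  assumes "s \<noteq> t" "s \<notin> C" "t \<notin> C" "finite C" "finite M" "\<And>e. e \<in> M \<Longrightarrow> s \<notin> e \<and> t \<notin> e"
    and "\<And>e. e \<in> M \<Longrightarrow> card e = 2" "0 \<le> p" "p \<le> 1"
  shows "(1 - p\<^sup>2) ^ card C * edge_factor p ^ card M \<le> unrel p s t (star s t C \<union> M)"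
  using assms(5-7)
proof (induction M rule: finite_induct)
  case empty
  then show ?case using unrel_star[OF assms(1-4), of "{}"] assms(4) by (simp add: sep_prob_empty_graph)
next
  case (insert e M)
  obtain x y where e: "e = {x, y}" "x \<noteq> y" using insert.prems(2)[of e] by (auto simp: card_2_iff)
  have "(1 - p\<^sup>2) ^ card C * edge_factor p ^ card (insert e M)
      = edge_factor p * ((1 - p\<^sup>2) ^ card C * edge_factor p ^ card M)"
    using insert by simp
  \<comment> \<open>The lower bound on \<open>edge_factor p\<close> supplies its
    nonnegativity.\<close>
  also have "\<dots> \<le> edge_factor p * unrel p s t (star s t C \<union> M)"
    using insert edge_factor_bounds(2)[OF assms(8,9)] by (intro mult_left_mono) auto
  also have "\<dots> \<le> unrel p s t (star s t C \<union> insert e M)"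
    unfolding e(1) using assms insert e by (intro unrel_star_insert_edge) auto
  finally show ?case .
qed

text \<open>Both inner vertices of a path of length three lie in \<open>C\<close>, so an edge that
  leaves \<open>C\<close> is on no short path.\<close>

lemma unrel_star_outer_edge:
  assumes "s \<noteq> t" "s \<notin> C" "t \<notin> C" "finite C" "s \<notin> e" "t \<notin> e" "\<not> e \<subseteq> C"
  shows "unrel p s t (star s t C \<union> {e}) = (1 - p\<^sup>2) ^ card C"
proof -
  have "sep_prob p C {e} = sep_prob p C {}"
    unfolding sep_prob_def using assms(7) by (intro bexp_cong refl) (auto simp: sep_def)
  moreover have "unrel p s t (star s t C \<union> {e}) = bexp p {e} (sep_prob p C)"
    using assms by (intro unrel_star) auto
  ultimately show ?thesis
    using assms by (simp add: bexp_insert sep_prob_empty_graph algebra_simps)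
qed

lemma unrel_star_inner_edge:
  assumes "s \<noteq> t" "s \<notin> C" "t \<notin> C" "finite C" "x \<in> C" "y \<in> C" "x \<noteq> y" "0 \<le> p"
  shows "unrel p s t (star s t C \<union> {{x, y}}) = edge_factor p * (1 - p\<^sup>2) ^ card C"
proof -
  have "unrel p s t (star s t C \<union> {{x, y}}) = bexp p {{x, y}} (sep_prob p C)"
    using assms by (intro unrel_star) auto
  also have "\<dots> = (1 - p) * sep_prob p C {} + p * sep_prob p C {{x, y}}"
    by (simp add: bexp_insert)
  finally show ?thesis using assms by (simp add: sep_prob_single_edge)
qed

subsection \<open>Symmetrization\<close>

lemma unrel_insert:
  assumes "finite E" "e \<notin> E"
  shows "unrel p s t (insert e E) =
    bexp p E (\<lambda>F. (1 - p) * of_bool (\<not> linked s t F) + p * of_bool (\<not> linked s t (insert e F)))"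
  unfolding unrel_def bexp_insert[OF assms] by (simp add: bexp_add bexp_cmult)

text \<open>Let \<open>{x, t}\<close> survive exactly when \<open>{x, y}\<close> would. Since
  \<open>{x, t}\<close> was missing, a short path through \<open>{x, y}\<close> must run
  \<open>s\<close>, \<open>x\<close>, \<open>y\<close>, \<open>t\<close>, and the new edge shortens
  it to \<open>s\<close>, \<open>x\<close>, \<open>t\<close>.\<close>

lemma unrel_shift:
  assumes "s \<noteq> t" "finite E" "{s, x} \<in> E" "{x, t} \<notin> E" "{x, y} \<in> E" "x \<noteq> y" "x \<noteq> s" "x \<noteq> t" "y \<noteq> s"
    and p: "0 \<le> p" "p \<le> 1"
  shows "unrel p s t (insert {x, t} (E - {{x, y}})) \<le> unrel p s t E"
    and "0 < p \<Longrightarrow> p < 1 \<Longrightarrow> unrel p s t (insert {x, t} (E - {{x, y}})) < unrel p s t E"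
proof -
  define E0 where "E0 = E - {{x, y}}"
  have E0: "finite E0" "{x, y} \<notin> E0" "{x, t} \<notin> E0" "E = insert {x, y} E0"
    using assms by (auto simp: E0_def)
  have "y \<noteq> t" using assms by auto
  have shift: "linked s t (insert {x, t} F)" if F: "F \<subseteq> E0" and l: "linked s t (insert {x, y} F)" for F
    using l
  proof (cases rule: linkedE)
    case 1
    then have "{s, t} \<in> F" using assms by (auto simp: doubleton_eq_iff)
    then show ?thesis by (simp add: linked_def)
  next
    case (2 a)
    then have "{s, a} \<in> F" "{a, t} \<in> F" using assms \<open>y \<noteq> t\<close> by (auto simp: doubleton_eq_iff)
    then show ?thesis using 2 unfolding linked_def by blast
  next
    case (3 a b)
    then have ab: "{s, a} \<in> F" "{b, t} \<in> F" using assms \<open>y \<noteq> t\<close> by (auto simp: doubleton_eq_iff)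
    show ?thesis
    proof (cases "{a, b} \<in> F")
      case True
      then show ?thesis using 3 ab unfolding linked_def by blast
    next
      case False
      then have "{a, b} = {x, y}" using 3 by simp
      moreover have "b \<noteq> x" using ab(2) F E0(3) by auto
      ultimately have "a = x" by (auto simp: doubleton_eq_iff)
      then show ?thesis using ab assms unfolding linked_def by blast
    qed
  qed
  let ?f = "\<lambda>e F. (1 - p) * of_bool (\<not> linked s t F) + p * of_bool (\<not> linked s t (insert e F)) :: real"
  have le: "?f {x, t} F \<le> ?f {x, y} F" if "F \<subseteq> E0" for F
    using shift[OF that] p by auto
  have u: "unrel p s t (insert {x, t} E0) = bexp p E0 (?f {x, t})" "unrel p s t E = bexp p E0 (?f {x, y})"
    using unrel_insert[OF E0(1,3)] unrel_insert[OF E0(1,2)] E0(4) by auto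
  show "unrel p s t (insert {x, t} (E - {{x, y}})) \<le> unrel p s t E"
    unfolding E0_def[symmetric] u by (intro bexp_mono p le)
  show "unrel p s t (insert {x, t} (E - {{x, y}})) < unrel p s t E" if "0 < p" "p < 1"
    unfolding E0_def[symmetric] u
  proof (rule bexp_strict_mono[OF that E0(1) le])
    \<comment> \<open>Strictness is witnessed by \<open>{s, x}\<close> as the only survivor in
      \<open>E0\<close>: it forms a short path with \<open>{x, t}\<close>, but not with
      \<open>{x, y}\<close>.\<close>
    show "{{s, x}} \<subseteq> E0" using assms by (auto simp: E0_def doubleton_eq_iff)
    have "linked s t {{x, t}, {s, x}}"
      using assms unfolding linked_def by blast
    moreover have "\<not> linked s t {{x, y}, {s, x}}"
    proof
      assume "linked s t {{x, y}, {s, x}}"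
      then show False
        using assms \<open>y \<noteq> t\<close> by (cases rule: linkedE) (auto simp: doubleton_eq_iff)
    qed
    ultimately show "?f {x, t} {{s, x}} < ?f {x, y} {{s, x}}" using that by simp
  qed
qed

text \<open>A path that enters \<open>x\<close> from \<open>s\<close> cannot continue, so
  \<open>{s, x}\<close> is on no path to \<open>t\<close>.\<close>

lemma unrel_pendant:
  assumes "s \<noteq> t" "finite E" "{s, x} \<in> E" "{x, t} \<notin> E" "\<And>y. {x, y} \<in> E \<Longrightarrow> y = s" "x \<noteq> s" "x \<noteq> t"
  shows "unrel p s t (E - {{s, x}}) = unrel p s t E"
proof -
  define E0 where "E0 = E - {{s, x}}"
  have E0: "finite E0" "{s, x} \<notin> E0" "E = insert {s, x} E0"
    using assms by (auto simp: E0_def)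
  have "linked s t F" if F: "F \<subseteq> E0" and l: "linked s t (insert {s, x} F)" for F
    using l
  proof (cases rule: linkedE)
    case 1
    then have "{s, t} \<in> F" using assms by (auto simp: doubleton_eq_iff)
    then show ?thesis by (simp add: linked_def)
  next
    case (2 a)
    then have "{a, t} \<in> F" using assms by (auto simp: doubleton_eq_iff)
    then have "a \<noteq> x" using F assms(4) by (auto simp: E0_def)
    then have "{s, a} \<in> F" using 2 by (auto simp: doubleton_eq_iff)
    then show ?thesis using 2 \<open>{a, t} \<in> F\<close> unfolding linked_def by blast
  next
    case (3 a b)
    then have ab: "{b, t} \<in> F" "{a, b} \<in> F" using assms by (auto simp: doubleton_eq_iff)
    then have "a \<noteq> x" using F 3 assms(5)[of b] by (auto simp: E0_def)
    then have "{s, a} \<in> F" using 3 by (auto simp: doubleton_eq_iff)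
    then show ?thesis using 3 ab unfolding linked_def by blast
  qed
  then have "linked s t (insert {s, x} F) \<longleftrightarrow> linked s t F" if "F \<subseteq> E0" for F
    using that linked_mono[of s t F "insert {s, x} F"] by blast
  then have "unrel p s t (insert {s, x} E0) = unrel p s t E0"
    unfolding unrel_insert[OF E0(1,2)] unfolding unrel_def
    by (intro bexp_cong) (simp_all add: algebra_simps)
  then have "unrel p s t E0 = unrel p s t E" by (simp only: E0(3)[symmetric])
  then show ?thesis by (simp only: E0_def)
qed

text \<open>The unreliability of the optimal graph with \<open>k\<close> edges besides the edge joining the terminals.\<close>

definition bnd :: "real \<Rightarrow> nat \<Rightarrow> real" where
  "bnd p k = (1 - p\<^sup>2) ^ (k div 2) * (if odd k then edge_factor p else 1)"

section \<open>Comparison of \<open>bnd\<close> for different numbers of edges\<close>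

context
  fixes p :: real
  assumes p: "0 \<le> p" "p \<le> 1"
begin

lemma one_minus_p2: "0 \<le> 1 - p\<^sup>2" "1 - p\<^sup>2 \<le> 1"
  using p by (auto simp: power_le_one)

lemma one_minus_p2_le_edge_factor: "1 - p\<^sup>2 \<le> edge_factor p"
proof -
  have "(edge_factor p)\<^sup>2 \<le> edge_factor p"
    using edge_factor_bounds(1,2)[OF p] by (simp add: power2_eq_square mult_left_le)
  then show ?thesis using edge_factor_bounds(3)[OF p] by linarith
qed

lemma bnd_nonneg: "0 \<le> bnd p k"
  using one_minus_p2 edge_factor_bounds(2)[OF p] by (simp add: bnd_def)

lemma bnd_pos: "p < 1 \<Longrightarrow> 0 < bnd p k"
  using p edge_factor_bounds(2)[OF p] by (simp add: bnd_def abs_square_less_1)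

text \<open>One more edge either adds a factor \<open>edge_factor p\<close> or replaces that factor
  by the smaller \<open>1 - p\<^sup>2\<close>.\<close>

lemma bnd_Suc_le: "bnd p (Suc k) \<le> bnd p k"
proof (cases "odd k")
  case True
  then show ?thesis
    using one_minus_p2 one_minus_p2_le_edge_factor by (simp add: bnd_def mult.commute mult_right_mono)
next
  case False
  then show ?thesis
    using one_minus_p2 edge_factor_bounds(1)[OF p] by (simp add: bnd_def mult_left_le)
qed

lemma bnd_Suc_less:
  assumes "0 < p" "p < 1"
  shows "bnd p (Suc k) < bnd p k"
proof -
  have pos: "0 < 1 - p\<^sup>2" using assms by (simp add: abs_square_less_1)
  have "(edge_factor p)\<^sup>2 \<le> edge_factor p"
    using edge_factor_bounds(1,2)[OF p] by (simp add: power2_eq_square mult_left_le)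
  then have "1 - p\<^sup>2 < edge_factor p"
    using edge_factor_bounds(5)[OF p assms] by linarith
  then show ?thesis
    using pos edge_factor_bounds(4)[OF p assms(1)]
    by (cases "odd k") (simp_all add: bnd_def mult.commute)
qed

text \<open>An ordinary edge thus improves the optimum by a factor no better than
  \<open>1 - p\<^sup>2\<close>, which is to be compared with the factor \<open>1 - p\<close> of the
  edge joining the terminals.\<close>

lemma bnd_Suc_ge: "(1 - p\<^sup>2) * bnd p k \<le> bnd p (Suc k)"
proof (cases "odd k")
  case True
  have "(1 - p\<^sup>2) ^ Suc (k div 2) * edge_factor p \<le> (1 - p\<^sup>2) ^ Suc (k div 2) * 1"
    using one_minus_p2 edge_factor_bounds(1)[OF p] by (intro mult_left_mono) auto
  then show ?thesis using True by (simp add: bnd_def mult.assoc)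
next
  case False
  have "(1 - p\<^sup>2) ^ (k div 2) * (1 - p\<^sup>2) \<le> (1 - p\<^sup>2) ^ (k div 2) * edge_factor p"
    using one_minus_p2 one_minus_p2_le_edge_factor by (intro mult_left_mono) auto
  then show ?thesis using False by (simp add: bnd_def mult.commute)
qed

lemma bnd_star_eq:
  "bnd p (2 * c + k) = (1 - p\<^sup>2) ^ c * ((1 - p\<^sup>2) ^ (k div 2) * (if odd k then edge_factor p else 1))"
  by (simp add: bnd_def power_add)

lemma edge_factor_power:
  "edge_factor p ^ k = ((edge_factor p)\<^sup>2) ^ (k div 2) * (if odd k then edge_factor p else 1)"
proof -
  have "edge_factor p ^ k = edge_factor p ^ (2 * (k div 2) + k mod 2)" by simp
  also have "\<dots> = ((edge_factor p)\<^sup>2) ^ (k div 2) * edge_factor p ^ (k mod 2)"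
    by (simp only: power_add power_mult)
  finally show ?thesis by (simp add: odd_iff_mod_2_eq_one)
qed

text \<open>Group the \<open>k\<close> middle edges in pairs and trade each pair, of factor
  \<open>(edge_factor p)\<^sup>2\<close>, for a vertex of factor \<open>1 - p\<^sup>2\<close>. For
  \<open>k \<ge> 2\<close> there is a pair, which makes the next bound strict.\<close>

lemma bnd_star_le: "bnd p (2 * c + k) \<le> (1 - p\<^sup>2) ^ c * edge_factor p ^ k"
  unfolding bnd_star_eq edge_factor_power[of k]
  using one_minus_p2 edge_factor_bounds(2,3)[OF p]
  by (intro mult_left_mono mult_right_mono power_mono) auto

lemma bnd_star_less:
  assumes "0 < p" "p < 1" "2 \<le> k"
  shows "bnd p (2 * c + k) < (1 - p\<^sup>2) ^ c * edge_factor p ^ k"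
proof -
  have "0 < 1 - p\<^sup>2" using assms by (simp add: abs_square_less_1)
  moreover have "(1 - p\<^sup>2) ^ (k div 2) < ((edge_factor p)\<^sup>2) ^ (k div 2)"
    using assms one_minus_p2 edge_factor_bounds(5)[OF p assms(1,2)]
    by (intro power_strict_mono) auto
  ultimately show ?thesis
    unfolding bnd_star_eq edge_factor_power[of k]
    using edge_factor_bounds(2)[OF p]
    by (intro mult_strict_left_mono mult_strict_right_mono) auto
qed

end

text \<open>The optimal edge sets once the edge joining the terminals is removed. Only edges are
  described, so isolated vertices are left open.\<close>

definition extremal :: "'a \<Rightarrow> 'a \<Rightarrow> 'a set set \<Rightarrow> bool" where
  "extremal s t E \<longleftrightarrow> (\<exists>C. finite C \<and> s \<notin> C \<and> t \<notin> C \<and>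
     (E = star s t C \<or> (\<exists>x\<in>C. \<exists>y\<in>C. x \<noteq> y \<and> E = insert {x, y} (star s t C))))"

lemma unrel_extremal:
  assumes "s \<noteq> t" "extremal s t E" "0 \<le> p"
  shows "unrel p s t E = bnd p (card E)"
proof -
  obtain C where C: "finite C" "s \<notin> C" "t \<notin> C"
    "E = star s t C \<or> (\<exists>x\<in>C. \<exists>y\<in>C. x \<noteq> y \<and> E = insert {x, y} (star s t C))"
    using assms(2) unfolding extremal_def by blast
  from C(4) show ?thesis
  proof (elim disjE bexE conjE)
    assume "E = star s t C"
    then show ?thesis
      using unrel_star[of s t C "{}" p] C assms by (simp add: sep_prob_empty_graph card_star bnd_def)
  next
    fix x y assume xy: "x \<in> C" "y \<in> C" "x \<noteq> y" "E = insert {x, y} (star s t C)"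
    have "{x, y} \<notin> star s t C"
      using star_meets_terminals[of "{x, y}" s t C] xy C by auto
    then have "card E = Suc (2 * card C)"
      using xy C assms by (simp add: card_star finite_star)
    then show ?thesis
      using unrel_star_inner_edge[of s t C x y p] C assms xy by (simp add: bnd_def)
  qed
qed

text \<open>For strictness, two or more middle edges lose in the trade for vertices. A single middle
  edge of a non-extremal set leaves \<open>C\<close> and is wasted, while \<open>bnd\<close>
  strictly decreases with the number of edges.\<close>

lemma unrel_ge_star:
  assumes "s \<noteq> t" "s \<notin> C" "t \<notin> C" "finite C" "finite M" "\<And>e. e \<in> M \<Longrightarrow> s \<notin> e \<and> t \<notin> e"
    and "\<And>e. e \<in> M \<Longrightarrow> card e = 2" and p: "0 \<le> p" "p \<le> 1"
  defines "E \<equiv> star s t C \<union> M"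
  shows "bnd p (card E) \<le> unrel p s t E"
    and "0 < p \<Longrightarrow> p < 1 \<Longrightarrow> \<not> extremal s t E \<Longrightarrow> bnd p (card E) < unrel p s t E"
proof -
  have "star s t C \<inter> M = {}" using assms(6) star_meets_terminals by fastforce
  then have card: "card E = 2 * card C + card M"
    unfolding E_def using assms by (simp add: card_Un_disjoint finite_star card_star)
  have ge: "(1 - p\<^sup>2) ^ card C * edge_factor p ^ card M \<le> unrel p s t E"
    unfolding E_def using assms by (intro unrel_star_ge)
  then show "bnd p (card E) \<le> unrel p s t E"
    using bnd_star_le[OF p, of "card C" "card M"] card by simp
  show "bnd p (card E) < unrel p s t E" if p1: "0 < p" "p < 1" and ne: "\<not> extremal s t E"
  proof (cases "2 \<le> card M")
    case True
    then show ?thesis using bnd_star_less[OF p p1 True, of "card C"] ge card by simp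
  next
    case False
    have "M \<noteq> {}"
      using ne assms(2-4) unfolding extremal_def E_def by auto
    then have "card M = 1" using False assms(5) by (cases "card M") auto
    then obtain e where e: "M = {e}" by (auto simp: card_1_singleton_iff)
    then obtain x y where xy: "e = {x, y}" "x \<noteq> y" using assms(7)[of e] by (auto simp: card_2_iff)
    have "\<not> e \<subseteq> C"
    proof
      assume "e \<subseteq> C"
      then have "extremal s t E"
        unfolding extremal_def E_def e xy(1) using assms(2-4) xy by (intro exI[of _ C]) auto
      then show False using ne by simp
    qed
    then have "unrel p s t E = (1 - p\<^sup>2) ^ card C"
      unfolding E_def e using assms e by (intro unrel_star_outer_edge) auto
    also have "\<dots> = bnd p (2 * card C)" by (simp add: bnd_def)
    also have "\<dots> > bnd p (card E)"
      using bnd_Suc_less[OF p p1] card \<open>card M = 1\<close> by simp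
    finally show ?thesis .
  qed
qed

lemma card_2_doubleton: "card {a, b} = 2 \<longleftrightarrow> a \<noteq> b"
  by (cases "a = b") auto

text \<open>Termination measure of the symmetrization: a shift lowers the number of edges avoiding the
  terminals, the removal of a pendant edge lowers the number of edges.\<close>

definition asym_measure :: "'a \<Rightarrow> 'a \<Rightarrow> 'a set set \<Rightarrow> nat" where
  "asym_measure s t E = card E + card {e \<in> E. s \<notin> e \<and> t \<notin> e}"

text \<open>If \<open>x\<close> has a neighbour other than \<open>s\<close>, shift that edge to
  \<open>t\<close>; otherwise drop the pendant edge. The first strictly lowers the unreliability,
  the second saves an edge at no cost, so the weak bound for the smaller instance gives strictness.
  The induction hypothesis is a premise so that the terminals can be exchanged.\<close>

lemma asymmetric_step:
  assumes "s \<noteq> t" "finite E" "\<And>e. e \<in> E \<Longrightarrow> card e = 2" "{s, t} \<notin> E" "{s, x} \<in> E" "{x, t} \<notin> E"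
    and p: "0 \<le> p" "p \<le> 1"
    and IH: "\<And>E'. asym_measure s t E' < asym_measure s t E \<Longrightarrow> finite E' \<Longrightarrow> (\<And>e. e \<in> E' \<Longrightarrow> card e = 2)
        \<Longrightarrow> {s, t} \<notin> E' \<Longrightarrow> bnd p (card E') \<le> unrel p s t E'"
  shows "bnd p (card E) \<le> unrel p s t E"
    and "0 < p \<Longrightarrow> p < 1 \<Longrightarrow> bnd p (card E) < unrel p s t E"
proof -
  have x: "x \<noteq> s" "x \<noteq> t" using assms(3)[OF assms(5)] assms(4,5) by (auto simp: insert_commute)
  have "bnd p (card E) \<le> unrel p s t E \<and> (0 < p \<longrightarrow> p < 1 \<longrightarrow> bnd p (card E) < unrel p s t E)"
  proof (cases "\<exists>y. {x, y} \<in> E \<and> y \<noteq> s")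
    case True
    then obtain y where y: "{x, y} \<in> E" "y \<noteq> s" by blast
    have "x \<noteq> y" using assms(3)[OF y(1)] by auto
    have "y \<noteq> t" using y assms(6) by auto
    let ?E = "insert {x, t} (E - {{x, y}})"
    have card: "card ?E = card E"
      using assms(2,6) card.remove[OF assms(2) y(1)] by (subst card_insert_disjoint) simp_all
    let ?mid = "\<lambda>E. {e \<in> E. s \<notin> e \<and> t \<notin> e}"
    have "?mid ?E \<subset> ?mid E" using y \<open>y \<noteq> t\<close> x by auto
    then have "card (?mid ?E) < card (?mid E)"
      using assms(2) by (intro psubset_card_mono) auto
    then have "asym_measure s t ?E < asym_measure s t E"
      unfolding asym_measure_def using card by linarith
    then have "bnd p (card ?E) \<le> unrel p s t ?E"
      using assms(2-4) x by (intro IH) (auto simp: card_2_doubleton doubleton_eq_iff)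
    then show ?thesis
      using unrel_shift[OF assms(1,2,5,6) y(1) \<open>x \<noteq> y\<close> x y(2) p] card by auto
  next
    case False
    let ?E = "E - {{s, x}}"
    have card: "card E = Suc (card ?E)" using assms(2,5) by (rule card.remove)
    have "card {e \<in> ?E. s \<notin> e \<and> t \<notin> e} \<le> card {e \<in> E. s \<notin> e \<and> t \<notin> e}"
      using assms(2) by (intro card_mono) auto
    then have "asym_measure s t ?E < asym_measure s t E"
      unfolding asym_measure_def using card by linarith
    then have "bnd p (card ?E) \<le> unrel p s t ?E"
      using assms(2-4) by (intro IH) auto
    moreover have "unrel p s t ?E = unrel p s t E"
      using assms x False by (intro unrel_pendant) auto
    ultimately show ?thesis
      using bnd_Suc_le[OF p, of "card ?E"] bnd_Suc_less[OF p, of "card ?E"] card by auto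
  qed
  then show "bnd p (card E) \<le> unrel p s t E"
    and "0 < p \<Longrightarrow> p < 1 \<Longrightarrow> bnd p (card E) < unrel p s t E" by auto
qed

text \<open>Induction on \<open>asym_measure\<close>: a vertex adjacent to just one terminal is
  handled by \<open>asymmetric_step\<close>, and without such a vertex the edge set is a star
  together with middle edges.\<close>

lemma unrel_ge_bnd_aux:
  assumes "s \<noteq> t" "finite E" "\<And>e. e \<in> E \<Longrightarrow> card e = 2" "{s, t} \<notin> E" and p: "0 \<le> p" "p \<le> 1"
  shows "bnd p (card E) \<le> unrel p s t E \<and>
    (0 < p \<longrightarrow> p < 1 \<longrightarrow> \<not> extremal s t E \<longrightarrow> bnd p (card E) < unrel p s t E)"
  using assms(2-4)
proof (induction "asym_measure s t E" arbitrary: E rule: less_induct)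
  case less
  show ?case
  proof (cases "\<exists>x. ({s, x} \<in> E) \<noteq> ({x, t} \<in> E)")
    case True
    then consider x where "{s, x} \<in> E" "{x, t} \<notin> E" | x where "{t, x} \<in> E" "{x, s} \<notin> E"
      by (metis insert_commute)
    then show ?thesis
    proof cases
      case 1
      then show ?thesis
        using asymmetric_step[OF assms(1) less.prems 1 p] less.hyps by blast
    next
      case 2
      \<comment> \<open>The measure and \<open>unrel\<close> are symmetric in the terminals, which
        transfers the induction hypothesis to the exchanged pair.\<close>
      have m: "asym_measure t s E' = asym_measure s t E'" for E'
        by (simp add: asym_measure_def conj_commute)
      have st: "{t, s} \<notin> E" using less.prems(3) by (simp add: insert_commute)
      have IH: "bnd p (card E') \<le> unrel p t s E'"
        if "asym_measure t s E' < asym_measure t s E" "finite E'" "\<And>e. e \<in> E' \<Longrightarrow> card e = 2" "{t, s} \<notin> E'" for E'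
        using less.hyps[of E'] that unfolding m unrel_sym[of p t s] insert_commute[of t s] by blast
      show ?thesis
        using asymmetric_step[OF assms(1)[symmetric] less.prems(1,2) st 2 p] IH
        unfolding unrel_sym[of p t s] by blast
    qed
  next
    case False
    \<comment> \<open>In this case \<open>s\<close> and \<open>t\<close> have the same neighbours,
      so \<open>C\<close> serves for both.\<close>
    define C where "C = {x. {s, x} \<in> E}"
    define M where "M = {e \<in> E. s \<notin> e \<and> t \<notin> e}"
    have sC: "s \<notin> C" using less.prems(2)[of "{s, s}"] by (auto simp: C_def)
    have tC: "t \<notin> C" using less.prems(3) by (simp add: C_def)
    have "finite ((\<lambda>x. {s, x}) ` C)"
      by (rule finite_subset[OF _ less.prems(1)]) (auto simp: C_def)
    then have fC: "finite C" using inj_on_doubleton by (rule finite_imageD)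
    have E: "E = star s t C \<union> M"
    proof (intro equalityI subsetI)
      fix e assume e: "e \<in> E"
      show "e \<in> star s t C \<union> M"
      proof (cases "s \<in> e \<or> t \<in> e")
        case True
        obtain a b where ab: "e = {a, b}" using less.prems(2)[OF e] by (auto simp: card_2_iff)
        then have "(\<exists>x. e = {s, x}) \<or> (\<exists>x. e = {t, x})" using True by auto
        then show ?thesis
        proof (elim disjE exE)
          fix x assume "e = {s, x}"
          then show ?thesis using e by (auto simp: star_def C_def)
        next
          fix x assume x: "e = {t, x}"
          then have "{x, t} \<in> E" using e by (simp add: insert_commute)
          then have "x \<in> C" using False by (simp add: C_def)
          then show ?thesis using x by (auto simp: star_def)
        qed
      next
        case False
        then show ?thesis using e by (simp add: M_def)
      qed
    next
      fix e assume "e \<in> star s t C \<union> M"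
      then consider x where "x \<in> C" "e = {s, x}" | x where "x \<in> C" "e = {t, x}" | "e \<in> M"
        by (auto simp: star_def)
      then show "e \<in> E"
      proof cases
        case 2
        then have "{x, t} \<in> E" using False by (simp add: C_def)
        then show ?thesis using 2 by (simp add: insert_commute)
      qed (auto simp: C_def M_def)
    qed
    have fM: "finite M" using less.prems(1) by (simp add: M_def)
    have M: "\<And>e. e \<in> M \<Longrightarrow> s \<notin> e \<and> t \<notin> e" "\<And>e. e \<in> M \<Longrightarrow> card e = 2"
      using less.prems(2) by (auto simp: M_def)
    show ?thesis
      using unrel_ge_star[OF assms(1) sC tC fC fM M p] unfolding E[symmetric] by simp
  qed
qed

lemmas unrel_ge_bnd = unrel_ge_bnd_aux[THEN conjunct1]
lemmas unrel_gt_bnd = unrel_ge_bnd_aux[THEN conjunct2, rule_format]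

section \<open>The edge joining the terminals\<close>

lemma unrel_insert_terminal_edge:
  assumes "finite E" "{s, t} \<notin> E"
  shows "unrel p s t (insert {s, t} E) = (1 - p) * unrel p s t E"
proof -
  have "linked s t (insert {s, t} F)" for F by (simp add: linked_def)
  then show ?thesis using assms by (simp add: unrel_def bexp_insert)
qed

text \<open>If \<open>{s, t}\<close> is present it contributes the factor \<open>1 - p\<close> and
  the rest obeys \<open>bnd\<close>. If it is absent, the unreliability is at least
  \<open>(1 - p\<^sup>2) * bnd p (card E - 1)\<close>, which is strictly larger for
  \<open>0 < p < 1\<close>.\<close>

lemma unrel_lower_bound:
  assumes "s \<noteq> t" "finite E" "\<And>e. e \<in> E \<Longrightarrow> card e = 2" "E \<noteq> {}" and p: "0 \<le> p" "p \<le> 1"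
  shows "(1 - p) * bnd p (card E - 1) \<le> unrel p s t E"
    and "0 < p \<Longrightarrow> p < 1 \<Longrightarrow> unrel p s t E \<le> (1 - p) * bnd p (card E - 1) \<Longrightarrow>
      {s, t} \<in> E \<and> extremal s t (E - {{s, t}})"
proof -
  have "(1 - p) * bnd p (card E - 1) \<le> unrel p s t E \<and> (0 < p \<longrightarrow> p < 1 \<longrightarrow>
      unrel p s t E \<le> (1 - p) * bnd p (card E - 1) \<longrightarrow> {s, t} \<in> E \<and> extremal s t (E - {{s, t}}))"
  proof (cases "{s, t} \<in> E")
    case True
    let ?E = "E - {{s, t}}"
    have u: "unrel p s t E = (1 - p) * unrel p s t ?E"
      using unrel_insert_terminal_edge[of ?E s t p] assms(2) True by (simp add: insert_absorb)
    have card: "card ?E = card E - 1" using True by (simp add: assms(2))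
    have ge: "bnd p (card ?E) \<le> unrel p s t ?E"
      using assms by (intro unrel_ge_bnd) auto
    have "extremal s t ?E" if "0 < p" "p < 1" "unrel p s t E \<le> (1 - p) * bnd p (card E - 1)"
    proof (rule ccontr)
      assume "\<not> extremal s t ?E"
      then have "bnd p (card ?E) < unrel p s t ?E"
        using assms that by (intro unrel_gt_bnd) auto
      then show False using that u card by simp
    qed
    then show ?thesis using ge p u card True by (simp add: mult_left_mono)
  next
    case False
    have c: "card E = Suc (card E - 1)" using assms(2,4) by (simp add: card_gt_0_iff)
    have ge: "bnd p (card E) \<le> unrel p s t E" using assms False by (intro unrel_ge_bnd) auto
    have "(1 - p\<^sup>2) * bnd p (card E - 1) \<le> bnd p (card E)"
      using bnd_Suc_ge[OF p, of "card E - 1"] c by simp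
    then have ge2: "(1 - p\<^sup>2) * bnd p (card E - 1) \<le> unrel p s t E" using ge by linarith
    have "p\<^sup>2 \<le> p" using p by (simp add: power2_eq_square mult_left_le)
    then have "(1 - p) * bnd p (card E - 1) \<le> (1 - p\<^sup>2) * bnd p (card E - 1)"
      using bnd_nonneg[OF p] by (intro mult_right_mono) auto
    moreover have "(1 - p) * bnd p (card E - 1) < (1 - p\<^sup>2) * bnd p (card E - 1)" if "0 < p" "p < 1"
      using that bnd_pos[OF p that(2)] by (intro mult_strict_right_mono) (auto simp: power2_eq_square)
    ultimately show ?thesis using ge2 by fastforce
  qed
  then show "(1 - p) * bnd p (card E - 1) \<le> unrel p s t E"
    and "0 < p \<Longrightarrow> p < 1 \<Longrightarrow> unrel p s t E \<le> (1 - p) * bnd p (card E - 1) \<Longrightarrow>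
      {s, t} \<in> E \<and> extremal s t (E - {{s, t}})" by auto
qed

subsection \<open>Extremal graphs\<close>

definition extremal_graph :: "'a ttg \<Rightarrow> bool" where
  "extremal_graph G \<longleftrightarrow> {term_s G, term_t G} \<in> edges G \<and>
     extremal (term_s G) (term_t G) (edges G - {{term_s G, term_t G}})"

lemma extremal_graphE:
  assumes "extremal_graph G"
  obtains C M where "finite C" "term_s G \<notin> C" "term_t G \<notin> C"
    "edges G = insert {term_s G, term_t G} (star (term_s G) (term_t G) C \<union> M)"
    "M = {} \<or> (\<exists>x\<in>C. \<exists>y\<in>C. x \<noteq> y \<and> M = {{x, y}})"
proof -
  let ?s = "term_s G" and ?t = "term_t G"
  have E: "edges G = insert {?s, ?t} (edges G - {{?s, ?t}})"
    using assms unfolding extremal_graph_def by blast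
  obtain C where C: "finite C" "?s \<notin> C" "?t \<notin> C"
    "edges G - {{?s, ?t}} = star ?s ?t C \<or>
      (\<exists>x\<in>C. \<exists>y\<in>C. x \<noteq> y \<and> edges G - {{?s, ?t}} = insert {x, y} (star ?s ?t C))"
    using assms unfolding extremal_graph_def extremal_def by blast
  from C(4) show ?thesis
  proof (elim disjE bexE conjE)
    assume "edges G - {{?s, ?t}} = star ?s ?t C"
    then show ?thesis using C(1-3) E by (intro that[of C "{}"]) auto
  next
    fix x y assume "x \<in> C" "y \<in> C" "x \<noteq> y" "edges G - {{?s, ?t}} = insert {x, y} (star ?s ?t C)"
    then show ?thesis using C(1-3) E by (intro that[of C "{{x, y}}"]) auto
  qed
qed

lemma extremal_graphI:
  assumes "term_s G \<noteq> term_t G" "finite C" "term_s G \<notin> C" "term_t G \<notin> C"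
    and "edges G = insert {term_s G, term_t G} (star (term_s G) (term_t G) C \<union> M)"
    and "M = {} \<or> (\<exists>x\<in>C. \<exists>y\<in>C. x \<noteq> y \<and> M = {{x, y}})"
  shows "extremal_graph G" "card (edges G) = 2 * card C + card M + 1"
proof -
  let ?s = "term_s G" and ?t = "term_t G"
  have st: "{?s, ?t} \<notin> star ?s ?t C" "{?s, ?t} \<notin> M"
    using assms by (auto simp: star_def doubleton_eq_iff)
  then have "edges G - {{?s, ?t}} = star ?s ?t C \<union> M" using assms(5) by auto
  then show "extremal_graph G"
    unfolding extremal_graph_def extremal_def using assms(2-6) by (intro conjI exI[of _ C]) auto
  have "star ?s ?t C \<inter> M = {}"
    using assms(3,4,6) star_meets_terminals[of _ ?s ?t C] by fastforce
  moreover have "finite M" using assms(6) by auto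
  ultimately show "card (edges G) = 2 * card C + card M + 1"
    using st assms(1-4) unfolding assms(5)
    by (simp add: finite_star card_Un_disjoint card_star)
qed

section \<open>Optimal value of the reliability\<close>

lemma wf_ttg_edges:
  assumes "wf_ttg G"
  shows "finite (edges G)" "\<And>e. e \<in> edges G \<Longrightarrow> card e = 2" "\<And>e. e \<in> edges G \<Longrightarrow> e \<subseteq> verts G"
proof -
  show sub: "\<And>e. e \<in> edges G \<Longrightarrow> e \<subseteq> verts G"
    using assms unfolding wf_ttg_def by auto
  show "\<And>e. e \<in> edges G \<Longrightarrow> card e = 2"
    using assms unfolding wf_ttg_def card_2_iff by blast
  have "edges G \<subseteq> Pow (verts G)" using sub by auto
  then show "finite (edges G)"
    using assms unfolding wf_ttg_def by (meson finite_Pow_iff finite_subset)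
qed

lemma rel_extremal_graph:
  assumes "in_T n m G" "extremal_graph G" "0 \<le> \<rho>" "\<rho> \<le> 1"
  shows "rel 3 G \<rho> = 1 - \<rho> * bnd (1 - \<rho>) (m - 1)"
proof -
  let ?s = "term_s G" and ?t = "term_t G"
  let ?E = "edges G - {{?s, ?t}}"
  have wf: "wf_ttg G" and m: "card (edges G) = m" using assms(1) by (auto simp: in_T_def)
  have st: "?s \<noteq> ?t" using wf by (simp add: wf_ttg_def)
  have ext: "{?s, ?t} \<in> edges G" "extremal ?s ?t ?E" using assms(2) by (auto simp: extremal_graph_def)
  have "unrel (1 - \<rho>) ?s ?t (edges G) = \<rho> * unrel (1 - \<rho>) ?s ?t ?E"
    using unrel_insert_terminal_edge[of ?E ?s ?t "1 - \<rho>"] wf_ttg_edges(1)[OF wf] ext(1)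
    by (simp add: insert_absorb)
  also have "\<dots> = \<rho> * bnd (1 - \<rho>) (m - 1)"
    using unrel_extremal[OF st ext(2)] assms(3,4) m ext(1) wf_ttg_edges(1)[OF wf] by simp
  finally show ?thesis by (simp add: rel_3_eq[OF wf])
qed

text \<open>By \<open>rel_extremal_graph\<close> the bound is the value of every extremal graph.
  Attaining it at a single \<open>\<rho>\<close> strictly between 0 and 1 already forces the
  structure, which yields uniqueness.\<close>

lemma rel_le:
  assumes "in_T n m G" "0 < m" "0 \<le> \<rho>" "\<rho> \<le> 1"
  shows "rel 3 G \<rho> \<le> 1 - \<rho> * bnd (1 - \<rho>) (m - 1)"
    and "0 < \<rho> \<Longrightarrow> \<rho> < 1 \<Longrightarrow> 1 - \<rho> * bnd (1 - \<rho>) (m - 1) \<le> rel 3 G \<rho> \<Longrightarrow> extremal_graph G"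
proof -
  let ?s = "term_s G" and ?t = "term_t G"
  have wf: "wf_ttg G" and m: "card (edges G) = m" using assms(1) by (auto simp: in_T_def)
  have st: "?s \<noteq> ?t" using wf by (simp add: wf_ttg_def)
  have ne: "edges G \<noteq> {}" using m assms(2) by auto
  note lb = unrel_lower_bound[OF st wf_ttg_edges(1,2)[OF wf] ne, of "1 - \<rho>"]
  show "rel 3 G \<rho> \<le> 1 - \<rho> * bnd (1 - \<rho>) (m - 1)"
    using lb(1) assms(3,4) m by (simp add: rel_3_eq[OF wf])
  show "extremal_graph G" if "0 < \<rho>" "\<rho> < 1" "1 - \<rho> * bnd (1 - \<rho>) (m - 1) \<le> rel 3 G \<rho>"
    using lb(2) that m unfolding extremal_graph_def by (simp add: rel_3_eq[OF wf])
qed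

section \<open>Existence and uniqueness of extremal graphs\<close>

lemma wf_ttg_star:
  assumes "finite (verts G)" "term_s G \<noteq> term_t G" "term_s G \<in> verts G" "term_t G \<in> verts G"
    and "C \<subseteq> verts G" "term_s G \<notin> C" "term_t G \<notin> C"
    and "edges G = insert {term_s G, term_t G} (star (term_s G) (term_t G) C \<union> M)"
    and "M = {} \<or> (\<exists>x\<in>C. \<exists>y\<in>C. x \<noteq> y \<and> M = {{x, y}})"
  shows "wf_ttg G"
proof -
  let ?P = "{{u, v} |u v. u \<in> verts G \<and> v \<in> verts G \<and> u \<noteq> v}"
  have P: "{u, v} \<in> ?P" if "u \<in> verts G" "v \<in> verts G" "u \<noteq> v" for u v
    using that by blast
  have "star (term_s G) (term_t G) C \<subseteq> ?P"
    unfolding star_def using assms(3-7) by (intro Un_least image_subsetI P) auto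
  moreover have "M \<subseteq> ?P"
    using assms(9)
  proof (elim disjE bexE conjE)
    fix x y assume "x \<in> C" "y \<in> C" "x \<noteq> y" "M = {{x, y}}"
    then show ?thesis using P[of x y] assms(5) by auto
  qed simp
  ultimately show ?thesis
    unfolding wf_ttg_def using assms(1-4,8) P[of "term_s G" "term_t G"] by simp
qed

text \<open>Optimality of a graph is tested only against graphs over its own vertex type, whereas
  \<open>H_graph\<close> lives on \<open>nat\<close>; this supplies an optimal competitor on any
  vertex set.\<close>

lemma ex_extremal_graph:
  assumes "finite V" "card V = n" "2 \<le> n" "5 \<le> m" "m \<le> 2 * n - 3"
  shows "\<exists>G. in_T n m G \<and> verts G = V \<and> extremal_graph G"
proof -
  obtain s where s: "s \<in> V" using assms(2,3) by fastforce
  have "card (V - {s}) = n - 1" using assms(1,2) s by simp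
  then have "V - {s} \<noteq> {}" using assms(3) by (metis card.empty Suc_1 diff_is_0_eq not_less_eq_eq)
  then obtain t where t: "t \<in> V" "t \<noteq> s" by auto
  \<comment> \<open>One edge joins the terminals and each vertex of \<open>C\<close> uses two; for
    even \<open>m\<close> one edge is left over. The bounds on \<open>m\<close> leave room for
    \<open>C\<close> and for two vertices in it.\<close>
  define c where "c = (m - 1) div 2"
  have "card (V - {s, t}) = n - 2" using assms(1,2) s t by (simp add: card_Diff_subset numeral_2_eq_2)
  moreover have "c \<le> n - 2" "2 \<le> c" using assms(4,5) by (auto simp: c_def)
  ultimately obtain C where C: "C \<subseteq> V - {s, t}" "card C = c" "finite C"
    by (metis obtain_subset_with_card_n)
  have "2 \<le> card C" using \<open>2 \<le> c\<close> C(2) by simp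
  then obtain D where "D \<subseteq> C" "card D = 2" by (metis obtain_subset_with_card_n)
  then obtain x y where xy: "x \<in> C" "y \<in> C" "x \<noteq> y" by (auto simp: card_2_iff)
  define M where "M = (if odd m then {} else {{x, y}})"
  define G where "G = \<lparr>verts = V, edges = insert {s, t} (star s t C \<union> M), term_s = s, term_t = t\<rparr>"
  have "extremal_graph G" "card (edges G) = 2 * card C + card M + 1"
    using C s t xy by (intro extremal_graphI[of G C M]; auto simp: G_def M_def)+
  moreover have "2 * card C + card M + 1 = m"
    using C(2) assms(4) by (cases "odd m") (auto simp: M_def c_def elim!: oddE evenE)
  moreover have "wf_ttg G"
    using assms(1) C s t xy by (intro wf_ttg_star[of G C M]) (auto simp: G_def M_def)
  ultimately show ?thesis
    using assms(2) by (intro exI[of _ G]) (auto simp: in_T_def G_def)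
qed

lemma bij_betw_extend:
  assumes "finite A" "finite B" "card A = card B" "A0 \<subseteq> A" "B0 \<subseteq> B" "bij_betw g A0 B0"
  obtains f where "bij_betw f A B" "\<And>x. x \<in> A0 \<Longrightarrow> f x = g x"
proof -
  have "card A0 = card B0" using assms(6) by (rule bij_betw_same_card)
  then have "card (A - A0) = card (B - B0)"
    using assms by (simp add: card_Diff_subset finite_subset)
  then obtain h where h: "bij_betw h (A - A0) (B - B0)"
    using assms(1,2) finite_same_card_bij[of "A - A0" "B - B0"] by blast
  define f where "f = (\<lambda>x. if x \<in> A0 then g x else h x)"
  have "bij_betw f A0 B0" using assms(6) by (rule bij_betw_cong[THEN iffD1, rotated]) (simp add: f_def)
  moreover have "bij_betw f (A - A0) (B - B0)"
    using h by (rule bij_betw_cong[THEN iffD1, rotated]) (simp add: f_def)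
  ultimately have "bij_betw f (A0 \<union> (A - A0)) (B0 \<union> (B - B0))"
    by (rule bij_betw_combine) auto
  moreover have "A0 \<union> (A - A0) = A" "B0 \<union> (B - B0) = B" using assms(4,5) by auto
  ultimately show ?thesis using that[of f] by (simp add: f_def)
qed

text \<open>The number of edges is \<open>2 * card C + card M + 1\<close> with
  \<open>card M \<le> 1\<close>, so it determines both cardinalities. Match the terminals, then
  \<open>C\<close> with the possible middle edge, and send the isolated vertices anywhere.\<close>

lemma extremal_graphs_iso:
  assumes G: "in_T n m G" "extremal_graph G" and H: "in_T n m H" "extremal_graph H"
  shows "ttg_iso G H"
proof -
  let ?s = "term_s G" and ?t = "term_t G" and ?s' = "term_s H" and ?t' = "term_t H"
  have wG: "wf_ttg G" and wH: "wf_ttg H" using G H by (auto simp: in_T_def)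
  then have st: "?s \<noteq> ?t" "?s \<in> verts G" "?t \<in> verts G" "finite (verts G)"
    and st': "?s' \<noteq> ?t'" "?s' \<in> verts H" "?t' \<in> verts H" "finite (verts H)"
    by (auto simp: wf_ttg_def)
  have cardV: "card (verts G) = card (verts H)" using G H by (simp add: in_T_def)
  obtain C M where C: "finite C" "?s \<notin> C" "?t \<notin> C" "edges G = insert {?s, ?t} (star ?s ?t C \<union> M)"
    "M = {} \<or> (\<exists>x\<in>C. \<exists>y\<in>C. x \<noteq> y \<and> M = {{x, y}})"
    using G(2) by (rule extremal_graphE)
  obtain C' M' where C': "finite C'" "?s' \<notin> C'" "?t' \<notin> C'" "edges H = insert {?s', ?t'} (star ?s' ?t' C' \<union> M')"
    "M' = {} \<or> (\<exists>x\<in>C'. \<exists>y\<in>C'. x \<noteq> y \<and> M' = {{x, y}})"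
    using H(2) by (rule extremal_graphE)
  have "2 * card C + card M + 1 = 2 * card C' + card M' + 1"
    using extremal_graphI(2)[OF st(1) C] extremal_graphI(2)[OF st'(1) C'] G H by (simp add: in_T_def)
  moreover have "card M \<le> 1" "card M' \<le> 1" using C(5) C'(5) by auto
  ultimately have cards: "card C = card C'" "card M = card M'" by presburger+
  obtain g where g: "bij_betw g C C'" "(`) g ` M = M'"
  proof (cases "M = {}")
    case True
    then have "M' = {}" using cards(2) C'(5) by auto
    then show ?thesis
      using that True finite_same_card_bij[OF C(1) C'(1) cards(1)] by auto
  next
    case False
    then obtain x y where xy: "x \<in> C" "y \<in> C" "x \<noteq> y" "M = {{x, y}}" using C(5) by auto
    then have "M' \<noteq> {}" using cards(2) by auto
    then obtain x' y' where xy': "x' \<in> C'" "y' \<in> C'" "x' \<noteq> y'" "M' = {{x', y'}}" using C'(5) by auto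
    have bij: "bij_betw (\<lambda>z. if z = x then x' else y') {x, y} {x', y'}"
      using xy(3) xy'(3) by (auto simp: bij_betw_def inj_on_def)
    have "{x, y} \<subseteq> C" "{x', y'} \<subseteq> C'" using xy xy' by auto
    then obtain g where "bij_betw g C C'" "\<And>z. z \<in> {x, y} \<Longrightarrow> g z = (if z = x then x' else y')"
      using bij_betw_extend[OF C(1) C'(1) cards(1) _ _ bij] by blast
    then show ?thesis using that[of g] xy xy' by auto
  qed
  define h where "h = g(?s := ?s', ?t := ?t')"
  have hC: "h z = g z" if "z \<in> C" for z using that C(2,3) by (auto simp: h_def)
  have "bij_betw h C C'" using g(1) by (rule bij_betw_cong[THEN iffD1, rotated]) (simp add: hC)
  moreover have "bij_betw h {?s, ?t} {?s', ?t'}"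
    using st(1) st'(1) by (auto simp: bij_betw_def inj_on_def h_def)
  ultimately have bij: "bij_betw h (C \<union> {?s, ?t}) (C' \<union> {?s', ?t'})"
    using C'(2,3) by (intro bij_betw_combine) auto
  have sub: "C \<union> {?s, ?t} \<subseteq> verts G"
  proof -
    have "z \<in> verts G" if "z \<in> C" for z
      using that wf_ttg_edges(3)[OF wG, of "{?s, z}"] C(4) by (auto simp: star_def)
    then show ?thesis using st by auto
  qed
  have sub': "C' \<union> {?s', ?t'} \<subseteq> verts H"
  proof -
    have "z \<in> verts H" if "z \<in> C'" for z
      using that wf_ttg_edges(3)[OF wH, of "{?s', z}"] C'(4) by (auto simp: star_def)
    then show ?thesis using st' by auto
  qed
  obtain f where f: "bij_betw f (verts G) (verts H)" "\<And>z. z \<in> C \<union> {?s, ?t} \<Longrightarrow> f z = h z"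
    using bij_betw_extend[OF st(4) st'(4) cardV sub sub' bij] by blast
  have fs: "f ?s = ?s'" "f ?t = ?t'" "\<And>z. z \<in> C \<Longrightarrow> f z = g z"
    using f(2) st(1) hC by (auto simp: h_def)
  have "(`) f ` star ?s ?t C = star ?s' ?t' C'"
  proof -
    have "(`) f ` star ?s ?t C = star ?s' ?t' (g ` C)"
      by (simp add: star_def image_Un image_image fs cong: image_cong)
    then show ?thesis using g(1) by (simp add: bij_betw_def)
  qed
  moreover have "(`) f ` M = (`) g ` M"
    using C(5) fs(3) by auto
  ultimately have edges: "edges H = (`) f ` edges G"
    using C(4) C'(4) g(2) fs(1,2) by (simp add: image_Un)
  have inj: "inj_on f (verts G)" using f(1) by (simp add: bij_betw_def)
  have "{u, v} \<in> edges G \<longleftrightarrow> {f u, f v} \<in> edges H" if "u \<in> verts G" "v \<in> verts G" for u v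
  proof
    assume "{u, v} \<in> edges G"
    then have "f ` {u, v} \<in> edges H" unfolding edges by (rule imageI)
    then show "{f u, f v} \<in> edges H" by simp
  next
    assume "{f u, f v} \<in> edges H"
    \<comment> \<open>Injectivity on the vertex set recovers an edge from its image.\<close>
    then obtain e where e: "e \<in> edges G" "f ` e = f ` {u, v}" unfolding edges by auto
    then have "e = {u, v}"
      using inj_on_image_eq_iff[OF inj wf_ttg_edges(3)[OF wG e(1)], of "{u, v}"] that by simp
    then show "{u, v} \<in> edges G" using e(1) by simp
  qed
  then show ?thesis
    unfolding ttg_iso_def using f(1) fs(1,2) by (intro exI[of _ f]) auto
qed

section \<open>The graph \<open>H_graph\<close> and its optimality\<close>

lemma H_graph_extremal:
  assumes "n \<ge> 6" "5 \<le> m" "m \<le> 2 * n - 3"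
  shows "in_T n m (H_graph n m)" "extremal_graph (H_graph n m)"
proof -
  define k where "k = (if even m then (m + 2) div 2 else (m + 3) div 2)"
  define M :: "nat set set" where "M = (if even m then {{3, 4}} else {})"
  \<comment> \<open>\<open>4 \<le> k\<close> provides the vertices 3 and 4 of the middle edge, and
    \<open>k \<le> n\<close> makes the truncated difference \<open>n - k\<close> exact.\<close>
  have k: "4 \<le> k" "k \<le> n" "2 * (k - 2) + card M + 1 = m"
    using assms by (auto simp: k_def M_def elim!: evenE oddE)
  let ?H = "H_graph n m"
  have S: "{{1::nat, i} |i. 3 \<le> i \<and> i \<le> k} = (\<lambda>x. {1, x}) ` {3..k}"
    "{{i, 2::nat} |i. 3 \<le> i \<and> i \<le> k} = (\<lambda>x. {2, x}) ` {3..k}"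
    by (auto simp: insert_commute)
  have J: "{{3::nat, 3 + j} |j. 1 \<le> j \<and> j \<le> (1::nat)} = {{3, 4}}"
    "{{3::nat, 3 + j} |j. 1 \<le> j \<and> j \<le> (0::nat)} = {}"
    by (auto simp: le_antisym intro!: exI[of _ 1])
  have A: "A_edges k 0 = insert {1, 2} (star 1 2 {3..k})"
    "A_edges k 1 = insert {1, 2} (star 1 2 {3..k} \<union> {{3, 4}})"
    unfolding A_edges_def star_def S J by (simp_all only: Un_insert_left Un_empty_left Un_empty_right Un_assoc)
  have H: "?H = \<lparr>verts = {1..n}, edges = insert {1, 2} (star 1 2 {3..k} \<union> M), term_s = 1, term_t = 2\<rparr>"
  proof -
    have V: "{1..k} \<union> {card {1..k} + 1..card {1..k} + (n - k)} = {1..n}" using k by auto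
    have E: "A_edges k (if even m then 1 else 0) = insert {1, 2} (star 1 2 {3..k} \<union> M)"
      using A unfolding M_def by simp
    have "?H = add_isolated (A_graph k (if even m then 1 else 0)) (n - k)"
      unfolding H_graph_def k_def by simp
    then show ?thesis unfolding add_isolated_def A_graph_def E by (simp only: V ttg.simps)
  qed
  have M: "M = {} \<or> (\<exists>x\<in>{3..k}. \<exists>y\<in>{3..k}. x \<noteq> y \<and> M = {{x, y}})"
  proof (cases "even m")
    case True
    then have "M = {{3, 4}}" by (simp add: M_def)
    moreover have "3 \<in> {3..k}" "4 \<in> {3..k}" "(3::nat) \<noteq> 4" using k(1) by auto
    ultimately show ?thesis by blast
  qed (simp add: M_def)
  have ext: "extremal_graph ?H" "card (edges ?H) = 2 * card {3..k} + card M + 1"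
    using M by (intro extremal_graphI[of ?H "{3..k}" M]; simp add: H)+
  show "extremal_graph ?H" by (fact ext)
  have "wf_ttg ?H"
    using k M by (intro wf_ttg_star[of ?H "{3..k}" M]) (simp_all add: H)
  moreover have "card (edges ?H) = m" using ext(2) k by simp
  ultimately show "in_T n m ?H" by (simp add: in_T_def H)
qed

theorem theorem3:
  fixes n m :: nat
  assumes "n \<ge> 6" and "5 \<le> m" and "m \<le> 2 * n - 3"
  shows "is_UMRTTG 3 n m (H_graph n m)
    \<and> (\<forall>G :: 'a ttg. is_UMRTTG 3 n m G \<longrightarrow> ttg_iso G (H_graph n m))"
proof (intro conjI allI impI)
  note H = H_graph_extremal[OF assms]
  show "is_UMRTTG 3 n m (H_graph n m)"
    unfolding is_UMRTTG_def
  proof (intro conjI allI impI ballI H(1))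
    fix K :: "nat ttg" and \<rho> :: real
    assume "in_T n m K" "\<rho> \<in> {0..1}"
    then show "rel 3 K \<rho> \<le> rel 3 (H_graph n m) \<rho>"
      using rel_le(1)[of n m K \<rho>] rel_extremal_graph[OF H] assms(2) by simp
  qed
next
  fix G :: "'a ttg"
  assume G: "is_UMRTTG 3 n m G"
  then have GT: "in_T n m G" by (simp add: is_UMRTTG_def)
  \<comment> \<open>An extremal graph over the type of \<open>G\<close> takes the place of
    \<open>H_graph\<close> in the comparison.\<close>
  obtain K :: "'a ttg" where K: "in_T n m K" "extremal_graph K"
    using ex_extremal_graph[of "verts G" n m] GT assms by (auto simp: in_T_def wf_ttg_def)
  \<comment> \<open>The value 1/2 is an arbitrary point of the open interval on which the equality
    case of \<open>rel_le\<close> applies.\<close>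
  then have "rel 3 K (1 / 2) \<le> rel 3 G (1 / 2)"
    using G by (simp add: is_UMRTTG_def)
  then have "extremal_graph G"
    using rel_le(2)[OF GT, of "1 / 2"] rel_extremal_graph[OF K, of "1 / 2"] assms(2) by simp
  then show "ttg_iso G (H_graph n m)"
    using extremal_graphs_iso[OF GT _ H_graph_extremal[OF assms]] by simp
qed

end
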